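(* Let $q$ be a fixed power of a prime $p$ and let $n\to\infty$. Let $A_0,\dots,A_{n-1}\subseteq\mathbb{F}_q$ be sets such that none of them is contained in a proper affine subspace of $\mathbb{F}_q$, viewed as a vector space over $\mathbb{F}_p$. The number of squarefree, monic polynomials of degree $n$ in $\mathbb{F}_q[t]$ whose coefficient of $t^i$ lies in $A_i$ for every $0\le i\le n-1$ is \[\kappa\left(\prod_{i=0}^{n-1}|A_i|\right)\left(1+O_q\bigl(q^{-n^{1/4}}\bigr)\right),\qquad \kappa=\frac1{1+1/q}\left(1-\frac{\mathbf{1}\{0\in A_0\}}{|A_0|}\cdot\frac{\mathbf{1}\{0\in A_1\}}{|A_1|}\right).\]
   Context: An affine subspace is a translate of an $\mathbb{F}_p$-linear subspace (single points included); proper means different from all of $\mathbb{F}_q$. $\mathbf{1}\{\cdot\}$ equals $1$ if the condition holds and $0$ otherwise. $O_q(\cdot)$ means that the implied constant depends only on $q$. *)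

theory Defs
  imports
    Complex_Main
    "HOL-Library.Cardinality"
    "HOL-Computational_Algebra.Primes"
    "HOL-Computational_Algebra.Polynomial"
    "HOL-Computational_Algebra.Squarefree"
begin

text \<open>
  In a ring of characteristic \<open>p\<close>, the subfield \<open>F\<^sub>p\<close> consists of the multiples of \<open>1\<close>.
\<close>

definition prime_subfield :: "'a::field set"
  where "prime_subfield = range of_nat"

definition Fp_subspace :: "'a::field set \<Rightarrow> bool"
  where "Fp_subspace V \<longleftrightarrow>
    0 \<in> V \<and> (\<forall>x\<in>V. \<forall>y\<in>V. x + y \<in> V) \<and> (\<forall>c\<in>prime_subfield. \<forall>x\<in>V. c * x \<in> V)"

definition Fp_affine_subspace :: "'a::field set \<Rightarrow> bool"
  where "Fp_affine_subspace S \<longleftrightarrow> (\<exists>V a. Fp_subspace V \<and> S = (\<lambda>x. a + x) ` V)"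

definition squarefree_polys :: "nat \<Rightarrow> (nat \<Rightarrow> 'a::field set) \<Rightarrow> 'a poly set"
  where "squarefree_polys n A =
    {f. squarefree f \<and> lead_coeff f = 1 \<and> degree f = n \<and> (\<forall>i<n. coeff f i \<in> A i)}"

definition kappa :: "(nat \<Rightarrow> 'a::finite_field set) \<Rightarrow> real"
  where "kappa A = 1 / (1 + 1 / real CARD('a)) *
    (1 - of_bool (0 \<in> A 0) / real (card (A 0)) * (of_bool (0 \<in> A 1) / real (card (A 1))))"

end

theory Submission
  imports Defs "HOL-Library.FuncSet" "HOL-Computational_Algebra.Polynomial_Factorial"
    "HOL-Number_Theory.Cong" "HOL-Real_Asymp.Real_Asymp"
begin

text \<open>
  Let \<open>f = t^n + \<Sum>a\<^sub>i t^i\<close> with each \<open>a\<^sub>i\<close> uniform on \<open>A\<^sub>i\<close>, independently. A polynomial is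
  squarefree iff no \<open>P\<^sup>2\<close> with \<open>P\<close> monic irreducible divides it. The prime \<open>P = t\<close> is exceptional, since
  \<open>t\<^sup>2\<close> divides \<open>f\<close> iff \<open>a\<^sub>0 = a\<^sub>1 = 0\<close>; this gives the second factor of \<open>\<kappa>\<close>. The other primes behave as for a
  uniformly random polynomial and contribute \<open>\<Prod>(1 - q^(-2 deg P)) = 1 / (1 + 1/q)\<close>. The proof is a sieve of
  level \<open>D\<close>, and three facts make it work.

  \<^item> Small squares. If \<open>g\<close> is coprime to \<open>t\<close> and of small degree, then \<open>f\<close> is equidistributed modulo \<open>g\<^sup>2\<close>
    (\<open>equidistribution_mod\<close>). Detect divisibility by the additive characters \<open>f \<mapsto> \<psi> (L f)\<close>, where \<open>L\<close> is a linear
    functional on \<open>F\<^sub>q[t]/(g\<^sup>2)\<close>. The average over \<open>f\<close> factors over the coefficients, and a factor with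
    \<open>L (t^i) \<noteq> 0\<close> has absolute value at most some \<open>\<theta> < 1\<close>, because \<open>A\<^sub>i\<close> lies in no proper affine subspace. As \<open>t\<close> is
    a unit modulo \<open>g\<^sup>2\<close>, a nonzero \<open>L\<close> cannot vanish on \<open>2 deg g\<close> consecutive powers of \<open>t\<close>, so about
    \<open>n / (2 deg g)\<close> factors are small.

  \<^item> Large squares. In characteristic \<open>p\<close> the derivative of \<open>f\<close> does not involve the coefficients \<open>a\<^sub>i\<close> with
    \<open>p\<close> dividing \<open>i\<close>. Freeze all coefficients except \<open>a\<^sub>0, a\<^sub>p, \<dots>\<close> (\<open>D\<close> of them). If \<open>P\<^sup>2\<close> divides \<open>f\<close>, then \<open>P\<close> is one
    of the at most \<open>n\<close> prime factors of the derivative, which is now fixed. For \<open>deg P > D\<close> each of them can divide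
    at most one of the remaining choices of \<open>f\<close>, which number at least \<open>2^D\<close>. The
    derivative itself vanishes only with probability at most \<open>2^(-D)\<close> (\<open>card_large_square_le\<close>).

  \<^item> Truncation. Let \<open>R\<close> be the set of primes whose square divides \<open>f\<close>. The sum of \<open>(-1)^|S|\<close> over the \<open>S \<subseteq> R\<close> of
    total degree at most \<open>D\<close> differs from the indicator of \<open>R = {}\<close> at most by the number of \<open>S \<subseteq> R\<close> with total
    degree in \<open>(D, 2D]\<close>, unless \<open>R\<close> contains a prime of degree above \<open>D\<close>
    (\<open>truncated_squarefree_indicator\<close>). By equidistribution the \<open>S\<close> in that window contribute about \<open>q^(-D)\<close>.

  Products of distinct monic irreducibles stand in for squarefree \<open>g\<close>, and \<open>(-1)^|S|\<close> for the Moebius function. The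
  Moebius function sums to \<open>1 - q\<close> over the polynomials of each positive degree coprime to \<open>t\<close>
  (\<open>moebius_sum_pos\<close>), so the truncated main term is a finite geometric sum. Altogether the relative error is at
  most a constant times \<open>q^(2D) D \<theta>^((n-2) div 4D) + D q^(-D) + n 2^(-D)\<close>. With \<open>D\<close> about \<open>n^(1/3)\<close> the exponents are of
  order \<open>n^(2/3)\<close> in the first term and \<open>n^(1/3)\<close> in the other two, which beats \<open>n^(1/4)\<close>.
\<close>

section \<open>Additive characters of a finite field\<close>

text \<open>
  Take a maximal proper additive subgroup \<open>H\<close> and some \<open>x\<close> outside it. By maximality every element has the form
  \<open>h + j x\<close> with \<open>h \<in> H\<close>. Since \<open>x\<close> has prime order \<open>p\<close> modulo \<open>H\<close>, sending \<open>h + j x\<close> to \<open>\<omega>^j\<close> for a primitive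
  \<open>p\<close>-th root of unity \<open>\<omega>\<close> is well defined.
\<close>
lemma exists_nontrivial_additive_character:
  "\<exists>\<psi> :: 'a::finite_field \<Rightarrow> complex.
     (\<forall>x y. \<psi> (x + y) = \<psi> x * \<psi> y) \<and> (\<forall>x. norm (\<psi> x) = 1) \<and> (\<exists>x. \<psi> x \<noteq> 1)"
proof -
  define p where "p = CHAR('a)"
  have p: "prime p" "of_nat p = (0::'a)" by (simp_all add: p_def)
  have p2: "p \<ge> 2" using p(1) by (rule prime_ge_2_nat)
  define subgp where "subgp = {H :: 'a set. 0 \<in> H \<and> (\<forall>x\<in>H. \<forall>y\<in>H. x + y \<in> H)}"
  have mult: "of_nat j * x \<in> H" if "H \<in> subgp" "x \<in> H" for H and x :: 'a and j
    using that by (induction j) (auto simp: subgp_def distrib_right)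
  have minus: "x - y \<in> H" if "H \<in> subgp" "x \<in> H" "y \<in> H" for H and x y :: 'a
  proof -
    have "of_nat (p - 1) * y = - y"
      using p(2) p2 by (simp add: of_nat_diff)
    then have "- y \<in> H" using mult[OF that(1,3), of "p - 1"] by simp
    then have "x + - y \<in> H" using that unfolding subgp_def by blast
    then show ?thesis by simp
  qed
  have "{0} \<in> subgp - {UNIV}"
  proof -
    have "(1::'a) \<notin> {0}" by simp
    then have "{0} \<noteq> (UNIV :: 'a set)" by blast
    then show ?thesis by (simp add: subgp_def)
  qed
  then obtain H where H: "H \<in> subgp - {UNIV}" and Hmax: "\<forall>K\<in>subgp - {UNIV}. H \<subseteq> K \<longrightarrow> H = K"
    using finite_has_maximal[of "subgp - {UNIV}"] by (metis (no_types, lifting) empty_iff finite)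
  obtain x where x: "x \<notin> H" using H by blast
  define K where "K = {h + of_nat j * x | h j. h \<in> H}"
  have "K \<in> subgp"
  proof -
    have H': "0 \<in> H" "\<And>a b. a \<in> H \<Longrightarrow> b \<in> H \<Longrightarrow> a + b \<in> H" using H by (auto simp: subgp_def)
    have "a + b \<in> K" if ab: "a \<in> K" "b \<in> K" for a b
    proof -
      obtain h i h' j where "h \<in> H" "a = h + of_nat i * x" "h' \<in> H" "b = h' + of_nat j * x"
        using ab by (auto simp: K_def)
      then have "a + b = (h + h') + of_nat (i + j) * x" "h + h' \<in> H"
        using H' by (auto simp: algebra_simps)
      then show ?thesis unfolding K_def by blast
    qed
    moreover have "0 + of_nat 0 * x \<in> K" using H' unfolding K_def by blast
    ultimately show ?thesis by (auto simp: subgp_def)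
  qed
  moreover have "H \<subset> K"
  proof
    show "H \<subseteq> K"
    proof
      fix h assume "h \<in> H"
      then have "h + of_nat 0 * x \<in> K" unfolding K_def by blast
      then show "h \<in> K" by simp
    qed
    have "0 + of_nat 1 * x \<in> K" using H unfolding K_def subgp_def by blast
    then show "H \<noteq> K" using x by auto
  qed
  ultimately have "K = UNIV"
    using Hmax by blast
  then have ex: "\<exists>j. y - of_nat j * x \<in> H" for y
    unfolding K_def by (smt (verit) UNIV_I add_diff_cancel_right' mem_Collect_eq)
  have dvd: "p dvd d" if "of_nat d * x \<in> H" for d
  proof (rule ccontr)
    assume "\<not> p dvd d"
    then have "coprime d p" using p(1) using prime_imp_coprime coprime_commute by blast
    then obtain e where "[d * e = 1] (mod p)" using cong_solve_coprime_nat by (metis One_nat_def)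
    then have "of_nat (d * e) = (1 :: 'a)"
      using of_nat_eq_iff_cong_CHAR[where ?'a = 'a, of "d * e" 1] by (simp add: p_def)
    then have eq: "of_nat e * (of_nat d * x) = x"
      by (simp only: of_nat_mult mult.assoc[symmetric] mult.commute[of "of_nat e"]) simp
    have "of_nat e * (of_nat d * x) \<in> H" using mult[OF _ that] H by simp
    then show False unfolding eq using x by contradiction
  qed
  define \<omega> where "\<omega> = cis (2 * pi / real p)"
  have \<omega>p: "\<omega> ^ p = 1" using p2 by (simp add: \<omega>_def DeMoivre)
  have \<omega>n: "norm \<omega> = 1" by (simp add: \<omega>_def)
  have \<omega>1: "\<omega> \<noteq> 1"
  proof
    assume "\<omega> = 1"
    have "inj_on (\<lambda>k. cis (2 * pi * real k / real p)) {..<p}"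
      using bij_betw_roots_unity[of p] p2 by (auto simp: bij_betw_def)
    then have "cis (2 * pi * real 1 / real p) \<noteq> cis (2 * pi * real 0 / real p)"
      using p2 by (auto dest!: inj_onD[where x = 1 and y = 0])
    then show False using \<open>\<omega> = 1\<close> by (simp add: \<omega>_def)
  qed
  have wd0: "\<omega> ^ i = \<omega> ^ j" if ij: "y - of_nat i * x \<in> H" "y - of_nat j * x \<in> H" "i \<le> j" for y i j
  proof -
    have "(y - of_nat i * x) - (y - of_nat j * x) \<in> H" using minus[OF _ ij(1,2)] H by simp
    then have "of_nat (j - i) * x \<in> H" using ij(3) by (simp add: of_nat_diff left_diff_distrib)
    then obtain m where "j - i = p * m" using dvd by (auto simp: dvd_def)
    then have "j = i + p * m" using ij(3) by simp
    then show ?thesis by (simp add: power_add power_mult \<omega>p)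
  qed
  have wd: "\<omega> ^ i = \<omega> ^ j" if "y - of_nat i * x \<in> H" "y - of_nat j * x \<in> H" for y i j
    using wd0[OF that] wd0[OF that(2,1)] nat_le_linear[of i j] by metis
  define J where "J y = (SOME j. y - of_nat j * x \<in> H)" for y
  have J: "y - of_nat (J y) * x \<in> H" for y using someI_ex[OF ex] by (simp add: J_def)
  define \<psi> where "\<psi> y = \<omega> ^ J y" for y
  have "\<psi> (y + z) = \<psi> y * \<psi> z" for y z
  proof -
    have "(y - of_nat (J y) * x) + (z - of_nat (J z) * x) \<in> H" 
      using J[of y] J[of z] H unfolding subgp_def by blast
    then have "(y + z) - of_nat (J y + J z) * x \<in> H" by (simp add: algebra_simps)
    from wd[OF J this] show ?thesis by (simp add: \<psi>_def power_add)
  qed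
  moreover have "norm (\<psi> y) = 1" for y by (simp add: \<psi>_def norm_power \<omega>n)
  moreover have "\<psi> x \<noteq> 1"
  proof -
    have "x - of_nat 1 * x \<in> H" using H by (simp add: subgp_def)
    from wd[OF J this] show ?thesis using \<omega>1 by (simp add: \<psi>_def)
  qed
  ultimately show ?thesis by blast
qed

definition affinely_spanning :: "'a::field set \<Rightarrow> bool"
  where "affinely_spanning A \<longleftrightarrow> \<not> (\<exists>S. Fp_affine_subspace S \<and> S \<noteq> UNIV \<and> A \<subseteq> S)"

text \<open>
  The kernel of \<open>\<psi>\<close> is a proper subspace over the prime field. If \<open>\<psi>\<close> were constant on \<open>A\<close>, then \<open>A\<close> would lie in a
  translate of this kernel.
\<close>
lemma affinely_spanning_additive_nonconstant:
  fixes \<psi> :: "'a::finite_field \<Rightarrow> complex"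
  assumes add: "\<And>x y. \<psi> (x + y) = \<psi> x * \<psi> y" and nz: "\<And>x. \<psi> x \<noteq> 0"
    and "\<psi> x0 \<noteq> 1" and A: "affinely_spanning A"
  obtains a b where "a \<in> A" "b \<in> A" "\<psi> a \<noteq> \<psi> b"
proof -
  define V where "V = {x. \<psi> x = 1}"
  have \<psi>0: "\<psi> 0 = 1" using add[of 0 0] nz[of 0] by simp
  have nat: "of_nat c * x \<in> V" if "x \<in> V" for c x
    using that by (induction c) (auto simp: V_def \<psi>0 add distrib_right)
  have V: "Fp_subspace V"
    unfolding Fp_subspace_def using nat by (auto simp: V_def \<psi>0 add prime_subfield_def)
  have aff: "Fp_affine_subspace ((\<lambda>x. a + x) ` V)" for a
    using V unfolding Fp_affine_subspace_def by blast
  have ne: "(\<lambda>x. a + x) ` V \<noteq> UNIV" for a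
  proof
    assume "(\<lambda>x. a + x) ` V = UNIV"
    then obtain x where "a + x0 = a + x" "x \<in> V" by (metis (no_types) UNIV_I imageE)
    then show False using assms(3) by (simp add: V_def)
  qed
  have "A \<noteq> {}" using A aff ne unfolding affinely_spanning_def by blast
  then obtain a where a: "a \<in> A" by blast
  have "\<not> A \<subseteq> (\<lambda>x. a + x) ` V" using A aff ne unfolding affinely_spanning_def by blast
  then obtain b where b: "b \<in> A" "b \<notin> (\<lambda>x. a + x) ` V" by blast
  then have "b - a \<notin> V" by (metis add_diff_cancel_left' diff_add_cancel add.commute imageI)
  moreover have "\<psi> b = \<psi> a * \<psi> (b - a)" using add[of a "b - a"] by simp
  ultimately have "\<psi> a \<noteq> \<psi> b" using nz by (auto simp: V_def)
  then show ?thesis using that a b by blast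
qed

lemma affinely_spanning_card_ge_2:
  fixes A :: "'a::finite_field set"
  assumes "affinely_spanning A"
  shows "card A \<ge> 2"
proof -
  obtain \<psi> :: "'a \<Rightarrow> complex" and x where \<psi>: "\<And>x y. \<psi> (x + y) = \<psi> x * \<psi> y" 
    "\<And>x. norm (\<psi> x) = 1" "\<psi> x \<noteq> 1"
    using exists_nontrivial_additive_character by blast
  have "\<psi> x \<noteq> 0" for x using \<psi>(2)[of x] by auto
  then obtain a b where "a \<in> A" "b \<in> A" "\<psi> a \<noteq> \<psi> b"
    using affinely_spanning_additive_nonconstant[of \<psi> x A] \<psi> assms by blast
  then have "{a, b} \<subseteq> A" "card {a, b} = 2" by (auto simp: card_2_iff)
  then show ?thesis using card_mono[of A "{a, b}"] by simp
qed

text \<open>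
  Strict convexity of the unit disc: by the parallelogram law, two different unit vectors have a sum of norm
  below \<open>2\<close>.
\<close>
lemma norm_sum_unit_less:
  fixes z :: "'b \<Rightarrow> complex"
  assumes "finite A" "\<And>a. a \<in> A \<Longrightarrow> norm (z a) = 1" "a \<in> A" "b \<in> A" "z a \<noteq> z b"
  shows "norm (\<Sum>a\<in>A. z a) < card A"
proof -
  have ab: "a \<noteq> b" using assms by auto
  have "norm (z a + z b) ^ 2 + norm (z a - z b) ^ 2 = 2 * norm (z a) ^ 2 + 2 * norm (z b) ^ 2"
    unfolding cmod_power2 by (simp add: power2_eq_square algebra_simps)
  moreover have "norm (z a - z b) ^ 2 > 0" using assms by simp
  moreover have "norm (z a) ^ 2 = 1" "norm (z b) ^ 2 = 1" using assms by auto
  ultimately have "norm (z a + z b) ^ 2 < 4" by linarith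
  then have "norm (z a + z b) ^ 2 < 2 ^ 2" by simp
  then have lt: "norm (z a + z b) < 2" by (rule power2_less_imp_less) simp
  have "(\<Sum>x\<in>A. z x) = z a + (z b + (\<Sum>x\<in>A - {a} - {b}. z x))"
    using assms ab by (simp add: sum.remove[of A a] sum.remove[of "A - {a}" b])
  then have "norm (\<Sum>x\<in>A. z x) \<le> norm (z a + z b) + norm (\<Sum>x\<in>A - {a} - {b}. z x)"
    by (metis add.assoc norm_triangle_ineq)
  also have "norm (\<Sum>x\<in>A - {a} - {b}. z x) \<le> real (card (A - {a} - {b}))"
    using sum_norm_le[of "A - {a} - {b}" z "\<lambda>_. 1"] assms by simp
  also have "card (A - {a} - {b}) = card A - 2" using assms ab by simp
  also have "card A \<ge> 2" using card_mono[of A "{a,b}"] assms ab by simp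
  then have "real (card A - 2) = real (card A) - 2" by simp
  finally show ?thesis using lt by simp
qed

text \<open>
  For each single pair \<open>(c, A)\<close> the ratio is strictly below \<open>1\<close>, and a finite field has only finitely many such
  pairs.
\<close>
lemma uniform_cancellation:
  fixes \<psi> :: "'a::finite_field \<Rightarrow> complex"
  assumes add: "\<And>x y. \<psi> (x + y) = \<psi> x * \<psi> y" and n1: "\<And>x. norm (\<psi> x) = 1"
    and nt: "\<psi> x0 \<noteq> 1"
  shows "\<exists>\<theta>::real. 1/2 \<le> \<theta> \<and> \<theta> < 1 \<and>
    (\<forall>c A. c \<noteq> 0 \<longrightarrow> affinely_spanning A \<longrightarrow> norm (\<Sum>a\<in>A. \<psi> (a * c)) \<le> \<theta> * card A)"
proof -
  define r where "r = (\<lambda>(c, A). norm (\<Sum>a\<in>A. \<psi> (a * c)) / card A)"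
  define R where "R = insert (1/2) (r ` {(c, A). c \<noteq> 0 \<and> affinely_spanning A})"
  have fin: "finite R" unfolding R_def by simp
  have lt: "norm (\<Sum>a\<in>A. \<psi> (a * c)) < card A" if "c \<noteq> 0" "affinely_spanning A" for c A
  proof -
    have h1: "\<psi> ((x + y) * c) = \<psi> (x * c) * \<psi> (y * c)" for x y
      by (simp only: distrib_right add)
    have h2: "\<psi> (a * c) \<noteq> 0" for a using n1[of "a * c"] by auto
    have h3: "\<psi> ((x0 / c) * c) \<noteq> 1" using nt that by simp
    obtain a b where "a \<in> A" "b \<in> A" "\<psi> (a * c) \<noteq> \<psi> (b * c)"
      using affinely_spanning_additive_nonconstant[of "\<lambda>a. \<psi> (a * c)", OF h1 h2 h3 \<open>affinely_spanning A\<close>]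
      by blast
    then show ?thesis using norm_sum_unit_less[of A "\<lambda>a. \<psi> (a * c)" a b] n1 by simp
  qed
  show ?thesis
  proof (intro exI[of _ "Max R"] conjI allI impI)
    show "1/2 \<le> Max R" using fin by (intro Max_ge) (auto simp: R_def)
    have "r (c, A) < 1" if "c \<noteq> 0" "affinely_spanning A" for c A
      using lt[OF that] affinely_spanning_card_ge_2[OF that(2)] by (simp add: r_def)
    then have "x < 1" if "x \<in> R" for x using that by (auto simp: R_def)
    then show "Max R < 1" using fin Max_in[of R] by (auto simp: R_def)
    show "norm (\<Sum>a\<in>A. \<psi> (a * c)) \<le> Max R * card A" if "c \<noteq> 0" "affinely_spanning A" for c A
    proof -
      have "r (c, A) \<le> Max R" using fin that by (intro Max_ge) (auto simp: R_def)
      then show ?thesis using affinely_spanning_card_ge_2[OF that(2)]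
        by (simp add: r_def pos_divide_le_eq)
    qed
  qed
qed

lemma character_orthogonality:
  fixes \<psi> :: "'a::finite_field \<Rightarrow> complex"
  assumes add: "\<And>x y. \<psi> (x + y) = \<psi> x * \<psi> y" and n1: "\<And>x. norm (\<psi> x) = 1"
    and nt: "\<psi> x0 \<noteq> 1"
  shows "(\<Sum>b\<in>UNIV. \<psi> (b * r)) = (if r = 0 then of_nat CARD('a) else 0)"
proof (cases "r = 0")
  case True
  have "\<psi> 0 \<noteq> 0" using n1[of 0] by auto
  then have "\<psi> 0 = 1" using add[of 0 0] by simp
  then show ?thesis using True by simp
next
  case False
  define c where "c = x0 / r"
  \<comment> \<open>Translating the summation variable by \<open>c\<close> multiplies the sum by \<open>\<psi> x0 \<noteq> 1\<close>.\<close>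
  have "(\<Sum>b\<in>UNIV. \<psi> (b * r)) = (\<Sum>b\<in>UNIV. \<psi> ((b + c) * r))"
    by (rule sum.reindex_bij_witness[of _ "\<lambda>b. b + c" "\<lambda>b. b - c"]) auto
  also have "\<dots> = (\<Sum>b\<in>UNIV. \<psi> (b * r)) * \<psi> x0"
    using False by (simp add: distrib_right add c_def sum_distrib_right)
  finally show ?thesis using nt False by (metis mult_cancel_left1)
qed

section \<open>Equidistribution modulo a polynomial coprime to t\<close>

definition restricted_polys :: "nat \<Rightarrow> (nat \<Rightarrow> 'a::field set) \<Rightarrow> 'a poly set"
  where "restricted_polys n A =
    {f. lead_coeff f = 1 \<and> degree f = n \<and> (\<forall>i<n. coeff f i \<in> A i)}"

definition monic_of :: "nat \<Rightarrow> (nat \<Rightarrow> 'a) \<Rightarrow> 'a::field poly"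
  where "monic_of n g = monom 1 n + (\<Sum>i<n. monom (g i) i)"

lemma coeff_monic_of: "coeff (monic_of n g) i = (if i < n then g i else if i = n then 1 else 0)"
  unfolding monic_of_def by (simp add: coeff_sum)

lemma bij_betw_monic_of: "bij_betw (monic_of n) (PiE {..<n} A) (restricted_polys n A)"
proof (rule bij_betw_byWitness[where f' = "\<lambda>f. restrict (coeff f) {..<n}"])
  have deg: "degree (monic_of n g) = n" for g :: "nat \<Rightarrow> 'a"
    by (intro antisym degree_le le_degree) (auto simp: coeff_monic_of)
  show "\<forall>g\<in>PiE {..<n} A. restrict (coeff (monic_of n g)) {..<n} = g"
    by (auto simp: coeff_monic_of fun_eq_iff PiE_iff extensional_def)
  show "\<forall>f\<in>restricted_polys n A. monic_of n (restrict (coeff f) {..<n}) = f"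
  proof
    fix f assume f: "f \<in> restricted_polys n A"
    have "coeff (monic_of n (restrict (coeff f) {..<n})) i = coeff f i" for i
      using f by (cases i n rule: linorder_cases)
        (auto simp: restricted_polys_def coeff_monic_of coeff_eq_0)
    then show "monic_of n (restrict (coeff f) {..<n}) = f" by (rule poly_eqI)
  qed
  show "monic_of n ` PiE {..<n} A \<subseteq> restricted_polys n A"
    unfolding restricted_polys_def by (intro image_subsetI CollectI) (simp add: deg coeff_monic_of PiE_mem)
  show "(\<lambda>f. restrict (coeff f) {..<n}) ` restricted_polys n A \<subseteq> PiE {..<n} A"
    unfolding restricted_polys_def by (intro image_subsetI restrict_PiE_iff[THEN iffD2]) simp
qed

lemma finite_restricted_polys [simp]: "finite (restricted_polys n (A :: nat \<Rightarrow> 'a::finite_field set))"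
  using bij_betw_finite[OF bij_betw_monic_of[of n A]] by (simp add: finite_PiE)

lemma card_restricted_polys:
  "card (restricted_polys n (A :: nat \<Rightarrow> 'a::finite_field set)) = (\<Prod>i<n. card (A i))"
  using bij_betw_same_card[OF bij_betw_monic_of[of n A]] by (simp add: card_PiE)

text \<open>
  Here \<open>L\<close> is a linear functional on \<open>F[t]/(M)\<close>, and \<open>t\<close> is a unit modulo \<open>M\<close>. Any \<open>deg M\<close> consecutive powers of
  \<open>t\<close> form a basis of this quotient. Equivalently, the linear recurring sequence \<open>L (t^i)\<close> is zero once it vanishes
  on a window of length \<open>deg M\<close>. From the window one gets \<open>L (t^s w) = 0\<close> for all \<open>w\<close> by reduction modulo \<open>M\<close>. The
  exponent \<open>s\<close> is then lowered to \<open>0\<close>, because adding a multiple of \<open>M\<close> makes \<open>w\<close> divisible by \<open>t\<close>.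
\<close>
lemma functional_vanishing_on_window:
  fixes L :: "'a::field poly \<Rightarrow> 'a"
  assumes add: "\<And>f g. L (f + g) = L f + L g" and scale: "\<And>c f. L (smult c f) = c * L f"
    and mult: "\<And>h. L (M * h) = 0" and M0: "coeff M 0 \<noteq> 0"
    and window: "\<And>i. s \<le> i \<Longrightarrow> i < s + degree M \<Longrightarrow> L (monom 1 i) = 0"
  shows "L f = 0"
proof -
  have L0: "L 0 = 0" using scale[of 0 0] by simp
  have Lsum: "L (\<Sum>i\<in>I. F i) = (\<Sum>i\<in>I. L (F i))" for I :: "nat set" and F
    by (induction I rule: infinite_finite_induct) (auto simp: L0 add)
  have small: "L (monom 1 s * w) = 0" if "w = 0 \<or> degree w < degree M" for w
  proof (cases "w = 0")
    case False
    have "monom 1 s * w = (\<Sum>j\<le>degree w. smult (coeff w j) (monom 1 (s + j)))"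
      by (subst (1) poly_as_sum_of_monoms[symmetric, of w])
        (simp add: sum_distrib_left mult_monom smult_monom)
    then show ?thesis using False that by (simp add: Lsum scale window)
  qed (simp add: L0)
  have all: "L (monom 1 s * w) = 0" for w
  proof -
    have "M \<noteq> 0" using M0 by auto
    have "monom 1 s * w = M * (monom 1 s * (w div M)) + monom 1 s * (w mod M)"
      by (simp only: mult.left_commute[of M] distrib_left[symmetric] mult_div_mod_eq)
    moreover have "L (monom 1 s * (w mod M)) = 0"
      by (rule small[OF degree_mod_less[OF \<open>M \<noteq> 0\<close>]])
    ultimately show ?thesis by (simp only: add mult) simp
  qed
  have "\<forall>w. L (monom 1 r * w) = 0 \<Longrightarrow> L w = 0" for r w
  proof (induction r arbitrary: w)
    case (Suc r)
    have "L (monom 1 r * w) = 0" for w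
    proof -
      \<comment> \<open>The constant \<open>c\<close> is chosen so that \<open>w + c M\<close> has no constant term and is therefore divisible by \<open>t\<close>.\<close>
      define c where "c = - coeff w 0 / coeff M 0"
      have "coeff (w + smult c M) 0 = 0" using M0 by (simp add: c_def)
      then obtain v where v: "w + smult c M = pCons 0 v" by (metis coeff_pCons_0 pCons_cases)
      have "monom 1 r * w = monom 1 r * (w + smult c M) + M * smult (- c) (monom 1 r)"
        by (simp add: algebra_simps smult_add_right[symmetric])
      also have "monom 1 r * (w + smult c M) = monom 1 (Suc r) * v"
        by (simp add: v monom_Suc mult_pCons_left mult_pCons_right)
      finally have eq: "monom 1 r * w = monom 1 (Suc r) * v + M * smult (- c) (monom 1 r)" .
      show ?thesis unfolding eq add mult using Suc.prems by simp
    qed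
    then show ?case using Suc.IH by blast
  qed simp
  then show ?thesis using all by blast
qed

text \<open>
  The interval from \<open>2\<close> to \<open>n\<close> contains \<open>(n - 2) div K\<close> disjoint windows of length \<open>K\<close>, each with at least one
  hit.
\<close>
lemma card_hits_ge_windows:
  fixes u :: "nat \<Rightarrow> 'a::zero"
  assumes hit: "\<And>s. \<exists>i. s \<le> i \<and> i < s + K \<and> u i \<noteq> 0" and K: "0 < K"
  shows "(n - 2) div K \<le> card {i\<in>{2..<n}. u i \<noteq> 0}"
proof -
  define c where "c j = (SOME i. 2 + j * K \<le> i \<and> i < 2 + j * K + K \<and> u i \<noteq> 0)" for j
  have c: "2 + j * K \<le> c j" "c j < 2 + j * K + K" "u (c j) \<noteq> 0" for j
    using someI_ex[OF hit[of "2 + j * K"]] by (auto simp: c_def)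
  have cdiv: "(c j - 2) div K = j" for j
    using c(1,2)[of j] K by (intro div_nat_eqI) (auto simp: algebra_simps)
  have "inj c" by (metis cdiv injI)
  have "c ` {..<(n - 2) div K} \<subseteq> {i\<in>{2..<n}. u i \<noteq> 0}"
  proof (clarsimp simp: c)
    fix j assume "j < (n - 2) div K"
    then have "(j + 1) * K \<le> (n - 2) div K * K" by (intro mult_right_mono) auto
    also have "\<dots> \<le> n - 2" by simp
    finally have "j * K + K \<le> n - 2" by simp
    then have "2 + j * K + K \<le> n" using K by simp
    then show "2 \<le> c j \<and> c j < n" using c(1,2)[of j] by linarith
  qed
  from card_mono[OF _ this] show ?thesis
    by (simp add: card_image inj_on_subset[OF \<open>inj c\<close>])
qed

text \<open>
  The constant \<open>\<theta>\<close> is one that works for all affinely spanning sets at once. The lower bound \<open>1/2\<close> keeps \<open>\<theta>\<close> positive,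
  so that its real powers behave as expected.
\<close>
locale cancelling_character =
  fixes \<psi> :: "'a::finite_field \<Rightarrow> complex" and \<theta> :: real
  assumes add: "\<psi> (x + y) = \<psi> x * \<psi> y" and norm_eq_1: "norm (\<psi> x) = 1"
    and nontrivial: "\<exists>x. \<psi> x \<noteq> 1" and \<theta>_ge: "1/2 \<le> \<theta>" and \<theta>_less: "\<theta> < 1"
    and cancel: "c \<noteq> 0 \<Longrightarrow> affinely_spanning A \<Longrightarrow> norm (\<Sum>a\<in>A. \<psi> (a * c)) \<le> \<theta> * card A"
begin

lemma at_zero: "\<psi> 0 = 1"
proof -
  have "\<psi> 0 \<noteq> 0" using norm_eq_1[of 0] by auto
  then show ?thesis using add[of 0 0] by simp
qed

lemma of_sum: "\<psi> (\<Sum>i\<in>I. f i) = (\<Prod>i\<in>I. \<psi> (f i))"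
  by (induction I rule: infinite_finite_induct) (auto simp: at_zero add)

lemma norm_product_le:
  assumes hit: "\<And>s. \<exists>i. s \<le> i \<and> i < s + K \<and> u i \<noteq> 0" and K: "0 < K"
    and A: "\<And>i. 2 \<le> i \<Longrightarrow> i < n \<Longrightarrow> affinely_spanning (A i)"
  shows "norm (\<Prod>i<n. \<Sum>a\<in>A i. \<psi> (a * u i)) \<le> (\<Prod>i<n. real (card (A i))) * \<theta> ^ ((n - 2) div K)"
proof -
  define Z where "Z = {i\<in>{2..<n}. u i \<noteq> 0}"
  have "norm (\<Prod>i<n. \<Sum>a\<in>A i. \<psi> (a * u i)) \<le> (\<Prod>i<n. real (card (A i)) * (if i \<in> Z then \<theta> else 1))"
    unfolding prod_norm[symmetric]
  proof (intro prod_mono conjI)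
    fix i assume "i \<in> {..<n}"
    show "norm (\<Sum>a\<in>A i. \<psi> (a * u i)) \<le> real (card (A i)) * (if i \<in> Z then \<theta> else 1)"
      using cancel[of "u i" "A i"] A[of i] sum_norm_le[of "A i" "\<lambda>a. \<psi> (a * u i)" "\<lambda>_. 1"]
      by (auto simp: Z_def norm_eq_1 mult.commute)
  qed auto
  also have "\<dots> = (\<Prod>i<n. real (card (A i))) * (\<Prod>i<n. if i \<in> Z then \<theta> else 1)"
    by (rule prod.distrib)
  also have "(\<Prod>i<n. if i \<in> Z then \<theta> else 1) = \<theta> ^ card Z"
    by (subst prod.If_cases) (auto simp: Z_def intro!: arg_cong[of _ _ "\<lambda>X. \<theta> ^ card X"])
  also have "\<theta> ^ card Z \<le> \<theta> ^ ((n - 2) div K)"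
    unfolding Z_def using \<theta>_ge \<theta>_less by (intro power_decreasing card_hits_ge_windows[OF hit K]) auto
  finally show ?thesis by (simp add: mult_left_mono prod_nonneg)
qed

text \<open>
  Divisibility by \<open>M\<close> means that the \<open>deg M\<close> coefficients of the remainder vanish, and each of these conditions is
  detected by orthogonality. Expanding the product gives a sum over the functionals \<open>L b\<close>, that is, over the linear
  combinations of the coefficients of the remainder. The functional \<open>b = 0\<close> produces the main term. Every other
  functional is nonzero on some \<open>t^i\<close> in each window of length \<open>K\<close>, so its exponential sum is small.

  Only the coefficients of index at least \<open>2\<close> are assumed to be spread out. Hence the result also applies after
  \<open>a\<^sub>0\<close> and \<open>a\<^sub>1\<close> have been forced to vanish.
\<close>
lemma equidistribution_mod:
  fixes M :: "'a poly" and A :: "nat \<Rightarrow> 'a set"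
  assumes M0: "coeff M 0 \<noteq> 0" and deg: "degree M \<le> K" and K: "0 < K"
    and A: "\<And>i. 2 \<le> i \<Longrightarrow> i < n \<Longrightarrow> affinely_spanning (A i)"
  shows "\<bar>real (card {f\<in>restricted_polys n A. M dvd f}) -
            (\<Prod>i<n. real (card (A i))) / real CARD('a) ^ degree M\<bar>
           \<le> (\<Prod>i<n. real (card (A i))) * \<theta> ^ ((n - 2) div K)"
proof -
  define m where "m = degree M"
  define q where "q = real CARD('a)"
  have q: "q > 0" by (simp add: q_def)
  define P where "P = (\<Prod>i<n. real (card (A i)))"
  define B where "B = PiE {..<m} (\<lambda>_. UNIV :: 'a set)"
  define L where "L b f = (\<Sum>j<m. b j * coeff (f mod M) j)" for b :: "nat \<Rightarrow> 'a" and f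
  have M: "M \<noteq> 0" using M0 by auto
  have L_add: "L b (f + g) = L b f + L b g" for b f g
    by (simp add: L_def poly_mod_add_left distrib_left sum.distrib)
  have L_scale: "L b (smult c f) = c * L b f" for b c f
    by (simp add: L_def mod_smult_left sum_distrib_left mult_ac)
  have L_mult: "L b (M * h) = 0" for b h by (simp add: L_def)
  have L_sum: "L b (\<Sum>i\<in>I. F i) = (\<Sum>i\<in>I. L b (F i))" for b and I :: "nat set" and F
    using L_scale[of b 0 0] by (induction I rule: infinite_finite_induct) (auto simp: L_add)
  have cardB: "card B = CARD('a) ^ m" by (simp add: B_def card_PiE)
  have finB: "finite B" by (simp add: B_def finite_PiE)
  obtain x0 where x0: "\<psi> x0 \<noteq> 1" using nontrivial by blast
  have dvd_iff: "M dvd f \<longleftrightarrow> (\<forall>j<m. coeff (f mod M) j = 0)" for f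
  proof
    assume "\<forall>j<m. coeff (f mod M) j = 0"
    then have "coeff (f mod M) j = 0" for j
      using degree_mod_less[OF M, of f] by (cases "j < m") (auto simp: m_def coeff_eq_0)
    then show "M dvd f" by (simp add: poly_eq_iff dvd_eq_mod_eq_0)
  qed (simp add: dvd_eq_mod_eq_0)
  \<comment> \<open>Orthogonality in each coefficient of the remainder.\<close>
  have detect: "complex_of_real (q ^ m) * of_bool (M dvd f) = (\<Sum>b\<in>B. \<psi> (L b f))" for f
  proof -
    have "(\<Sum>b\<in>B. \<psi> (L b f)) = (\<Prod>j<m. \<Sum>y\<in>UNIV. \<psi> (y * coeff (f mod M) j))"
      unfolding B_def L_def of_sum by (rule prod_sum_PiE[symmetric]) auto
    also have "\<dots> = (\<Prod>j<m. if coeff (f mod M) j = 0 then of_real q else 0)"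
      by (intro prod.cong refl, subst character_orthogonality[of \<psi> x0])
        (auto simp: add norm_eq_1 x0 q_def)
    also have "\<dots> = complex_of_real (q ^ m) * of_bool (M dvd f)"
    proof (cases "M dvd f")
      case True
      then show ?thesis using dvd_iff[of f] by simp
    next
      case False
      then show ?thesis using dvd_iff[of f] by auto
    qed
    finally show ?thesis by simp
  qed
  define E where "E b = (\<Sum>f\<in>restricted_polys n A. \<psi> (L b f))" for b
  have E_eq: "E b = \<psi> (L b (monom 1 n)) * (\<Prod>i<n. \<Sum>a\<in>A i. \<psi> (a * L b (monom 1 i)))" for b
  proof -
    have "L b (monic_of n g) = L b (monom 1 n) + (\<Sum>i<n. g i * L b (monom 1 i))" for g
    proof -
      have "L b (monom (g i) i) = g i * L b (monom 1 i)" for i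
        using L_scale[of b "g i" "monom 1 i"] by (simp add: smult_monom)
      then show ?thesis by (simp add: monic_of_def L_add L_sum)
    qed
    then have "E b = (\<Sum>g\<in>PiE {..<n} A. \<psi> (L b (monom 1 n)) * (\<Prod>i<n. \<psi> (g i * L b (monom 1 i))))"
      unfolding E_def by (simp add: sum.reindex_bij_betw[OF bij_betw_monic_of, symmetric] add of_sum)
    also have "\<dots> = \<psi> (L b (monom 1 n)) * (\<Prod>i<n. \<Sum>a\<in>A i. \<psi> (a * L b (monom 1 i)))"
      by (subst prod_sum_PiE) (auto simp: sum_distrib_left)
    finally show ?thesis .
  qed
  define b0 where "b0 = (\<lambda>j\<in>{..<m}. 0 :: 'a)"
  have b0: "b0 \<in> B" by (simp add: b0_def B_def)
  have E0: "E b0 = of_real P"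
    unfolding E_def L_def b0_def by (simp add: at_zero P_def card_restricted_polys)
  have E_le: "norm (E b) \<le> P * \<theta> ^ ((n - 2) div K)" if b: "b \<in> B" "b \<noteq> b0" for b
  proof -
    have "\<exists>i. s \<le> i \<and> i < s + K \<and> L b (monom 1 i) \<noteq> 0" for s
    proof (rule ccontr)
      assume neg: "\<not> ?thesis"
      have L0: "L b f = 0" for f
        by (rule functional_vanishing_on_window[of "L b" M s])
          (use L_add L_scale L_mult M0 neg deg in auto)
      have "b j = b0 j" for j
      proof (cases "j < m")
        case True
        have "monom 1 j mod M = (monom 1 j :: 'a poly)"
          using True by (intro mod_poly_less) (simp add: degree_monom_eq m_def)
        then have "L b (monom 1 j) = b j"
          using True by (simp add: L_def if_distrib cong: if_cong)
        then show ?thesis using True L0 by (simp add: b0_def)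
      next
        case False
        then show ?thesis using b by (auto simp: B_def b0_def PiE_iff extensional_def)
      qed
      then show False using b by auto
    qed
    then have "norm (\<Prod>i<n. \<Sum>a\<in>A i. \<psi> (a * L b (monom 1 i))) \<le> P * \<theta> ^ ((n - 2) div K)"
      unfolding P_def by (rule norm_product_le) (use K A in auto)
    then show ?thesis by (simp add: E_eq norm_mult norm_eq_1)
  qed
  have "complex_of_real (q ^ m * real (card {f\<in>restricted_polys n A. M dvd f}))
      = (\<Sum>f\<in>restricted_polys n A. complex_of_real (q ^ m) * of_bool (M dvd f))"
    by (simp add: sum_distrib_left[symmetric] of_bool_def sum.If_cases Int_def)
  also have "\<dots> = (\<Sum>b\<in>B. E b)"
    unfolding detect E_def by (rule sum.swap)
  also have "\<dots> = of_real P + (\<Sum>b\<in>B - {b0}. E b)"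
    using b0 finB by (simp add: sum.remove E0)
  finally have eq: "complex_of_real (q ^ m * real (card {f\<in>restricted_polys n A. M dvd f}) - P)
      = (\<Sum>b\<in>B - {b0}. E b)" by simp
  have P0: "P \<ge> 0" by (simp add: P_def prod_nonneg)
  have "\<bar>q ^ m * real (card {f\<in>restricted_polys n A. M dvd f}) - P\<bar> = norm (\<Sum>b\<in>B - {b0}. E b)"
    unfolding eq[symmetric] norm_of_real by simp
  also have "\<dots> \<le> (\<Sum>b\<in>B - {b0}. P * \<theta> ^ ((n - 2) div K))"
    by (rule sum_norm_le) (use E_le in auto)
  also have "\<dots> \<le> q ^ m * (P * \<theta> ^ ((n - 2) div K))"
  proof -
    have "card (B - {b0}) \<le> CARD('a) ^ m" using cardB finB by (metis card_mono Diff_subset)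
    then have "real (card (B - {b0})) \<le> q ^ m" by (simp add: q_def flip: of_nat_power)
    then show ?thesis using P0 \<theta>_ge by (simp add: mult_right_mono)
  qed
  finally have "\<bar>q ^ m * (real (card {f\<in>restricted_polys n A. M dvd f}) - P / q ^ m)\<bar>
      \<le> q ^ m * (P * \<theta> ^ ((n - 2) div K))"
    using q by (simp add: right_diff_distrib)
  then show ?thesis using q unfolding abs_mult by (simp add: P_def m_def q_def)
qed

end

lemma exists_cancelling_character: "\<exists>(\<psi> :: 'a::finite_field \<Rightarrow> complex) \<theta>. cancelling_character \<psi> \<theta>"
proof -
  obtain \<psi> :: "'a \<Rightarrow> complex" where \<psi>: "\<forall>x y. \<psi> (x + y) = \<psi> x * \<psi> y"
    "\<forall>x. norm (\<psi> x) = 1" "\<exists>x. \<psi> x \<noteq> 1"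
    using exists_nontrivial_additive_character by metis
  then obtain x0 where x0: "\<psi> x0 \<noteq> 1" by blast
  obtain \<theta> :: real where \<theta>: "1/2 \<le> \<theta>" "\<theta> < 1"
    "\<forall>c A. c \<noteq> 0 \<longrightarrow> affinely_spanning A \<longrightarrow> norm (\<Sum>a\<in>A. \<psi> (a * c)) \<le> \<theta> * card A"
    using uniform_cancellation[OF \<psi>(1)[rule_format] \<psi>(2)[rule_format] x0] by (elim exE conjE)
  have "cancelling_character \<psi> \<theta>"
    by (rule cancelling_character.intro) (fact \<theta>(1,2) | simp add: \<psi> \<theta>)+
  then show ?thesis by (intro exI)
qed

section \<open>Monic irreducible polynomials and truncated inclusion-exclusion\<close>

definition monic_irreducibles :: "'a::field poly set"
  where "monic_irreducibles = {P. irreducible P \<and> lead_coeff P = 1}"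

lemma monic_irreducibleD:
  assumes "P \<in> monic_irreducibles"
  shows "prime_elem P" "P \<noteq> 0" "lead_coeff P = 1" "0 < degree P" "\<not> is_unit P"
proof -
  have irr: "irreducible P" and lc: "lead_coeff P = 1" using assms by (auto simp: monic_irreducibles_def)
  show "prime_elem P" using irr by (rule field_poly_irreducible_imp_prime)
  show "P \<noteq> 0" "\<not> is_unit P" using irr by (auto simp: irreducible_def)
  then show "0 < degree P" by (auto simp: is_unit_iff_degree)
  show "lead_coeff P = 1" by (rule lc)
qed

lemma monic_irreducible_dvd_iff:
  assumes P: "P \<in> monic_irreducibles" and Q: "Q \<in> monic_irreducibles"
  shows "P dvd Q \<longleftrightarrow> P = Q"
proof
  assume "P dvd Q"
  then obtain h where h: "Q = P * h" by (elim dvdE)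
  have "irreducible Q" using Q by (simp add: monic_irreducibles_def)
  then have "is_unit h" using h monic_irreducibleD(5)[OF P] by (auto dest: irreducibleD)
  then obtain c where "h = [:c:]" using is_unit_polyE by blast
  moreover have "lead_coeff h = 1"
    using h monic_irreducibleD(3)[OF P] monic_irreducibleD(3)[OF Q] by (simp add: lead_coeff_mult)
  ultimately show "P = Q" using h by simp
qed simp

lemma monic_irreducible_dvd_prod_iff:
  assumes "finite S" "S \<subseteq> monic_irreducibles" and P: "P \<in> monic_irreducibles"
  shows "P dvd \<Prod>S \<longleftrightarrow> P \<in> S"
  using assms(1,2)
proof (induction S)
  case empty
  then show ?case using monic_irreducibleD(5)[OF P] by simp
next
  case (insert Q S)
  then show ?case
    using monic_irreducibleD(1)[OF P] monic_irreducible_dvd_iff[OF P, of Q]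
    by (simp add: prime_elem_dvd_mult_iff)
qed

lemma inj_on_prod_monic_irreducibles:
  "inj_on (\<lambda>S. \<Prod>S) {S. finite S \<and> S \<subseteq> (monic_irreducibles :: 'a::field poly set)}"
proof (rule inj_onI; clarify)
  fix S T :: "'a poly set"
  assume *: "finite S" "finite T" "S \<subseteq> monic_irreducibles" "T \<subseteq> monic_irreducibles" "\<Prod>S = \<Prod>T"
  then have "P \<in> S \<longleftrightarrow> P \<in> T" if "P \<in> monic_irreducibles" for P
    using monic_irreducible_dvd_prod_iff[of S P] monic_irreducible_dvd_prod_iff[of T P] that by simp
  then show "S = T" using * by blast
qed

lemma lead_coeff_prod_monic_irreducibles:
  "S \<subseteq> monic_irreducibles \<Longrightarrow> lead_coeff (\<Prod>S) = (1 :: 'a::field)"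
  unfolding lead_coeff_prod by (intro prod.neutral) (auto dest: monic_irreducibleD(3))

lemma degree_prod_monic_irreducibles:
  "finite S \<Longrightarrow> S \<subseteq> (monic_irreducibles :: 'a::field poly set) \<Longrightarrow> degree (\<Prod>S) = (\<Sum>P\<in>S. degree P)"
proof (induction S rule: finite_induct)
  case (insert P S)
  have "P \<noteq> 0" "\<Prod>S \<noteq> 0"
    using insert.prems monic_irreducibleD(2)[of P] lead_coeff_prod_monic_irreducibles[of S] by auto
  then show ?case using insert by (simp add: degree_mult_eq)
qed simp

text \<open>
  Distinct monic irreducibles are coprime, so their powers divide \<open>f\<close> separately iff the product of these powers
  does.
\<close>
lemma prod_power_dvd_iff:
  assumes "finite S" "S \<subseteq> (monic_irreducibles :: 'a::field poly set)"
  shows "(\<Prod>S) ^ k dvd f \<longleftrightarrow> (\<forall>P\<in>S. P ^ k dvd f)"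
proof
  assume "(\<Prod>S) ^ k dvd f"
  then show "\<forall>P\<in>S. P ^ k dvd f"
    using assms(1) by (meson dvd_prodI dvd_power_same dvd_trans)
next
  assume "\<forall>P\<in>S. P ^ k dvd f"
  then show "(\<Prod>S) ^ k dvd f"
    using assms(2)
  proof (induction arbitrary: f rule: finite_induct[OF assms(1)])
    case (2 P S)
    note insert = 2
    then have "P ^ k dvd f" by simp
    then obtain h where h: "f = P ^ k * h" by (rule dvdE)
    have "Q ^ k dvd h" if Q: "Q \<in> S" for Q
    proof -
      have "\<not> Q dvd P" using insert Q monic_irreducible_dvd_iff[of Q P] by auto
      moreover have pr: "prime_elem Q" using insert Q monic_irreducibleD(1) by blast
      ultimately have "\<not> Q dvd P ^ k" using prime_elem_dvd_power by blast
      moreover have "Q ^ k dvd P ^ k * h" using insert Q h by auto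
      ultimately show ?thesis using prime_elem_power_dvd_cases[of Q k "P ^ k" h 1 k] pr by auto
    qed
    then have "(\<Prod>S) ^ k dvd h" using insert by auto
    then show ?case using insert h by (simp add: power_mult_distrib mult_dvd_mono)
  qed simp
qed

lemma exists_monic_irreducible_divisor:
  fixes f :: "'a::field poly"
  assumes "0 < degree f"
  obtains P where "P \<in> monic_irreducibles" "P dvd f"
proof -
  have "\<exists>P\<in>monic_irreducibles. P dvd f"
    using assms
  proof (induction "degree f" arbitrary: f rule: less_induct)
    case less
    have f0: "f \<noteq> 0" using less.prems by auto
    show ?case
    proof (cases "irreducible f")
      case True
      define P where "P = smult (inverse (lead_coeff f)) f"
      have "lead_coeff P = 1" "P dvd f" "f dvd P" using f0 by (auto simp: P_def smult_dvd_iff dvd_smult)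
      moreover have "irreducible P"
      proof -
        have "P = [:inverse (lead_coeff f):] * f" by (simp add: P_def)
        moreover have "is_unit [:inverse (lead_coeff f):]"
          using f0 by (simp add: is_unit_iff_degree)
        ultimately show ?thesis using True irreducible_mult_unit_left by metis
      qed
      ultimately show ?thesis by (auto simp: monic_irreducibles_def)
    next
      case False
      moreover have "\<not> is_unit f" using less.prems f0 by (simp add: is_unit_iff_degree)
      ultimately obtain a b where ab: "f = a * b" "\<not> is_unit a" "\<not> is_unit b"
        using f0 by (auto simp: irreducible_def)
      then have "a \<noteq> 0" "b \<noteq> 0" using f0 by auto
      then have "0 < degree a" "0 < degree b" "degree f = degree a + degree b"
        using ab by (auto simp: is_unit_iff_degree degree_mult_eq)
      then obtain P where "P \<in> monic_irreducibles" "P dvd a" using less.hyps[of a] by auto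
      then show ?thesis using ab(1) dvd_mult2 by blast
    qed
  qed
  then show ?thesis using that by blast
qed

lemma card_irreducible_divisors_le_degree:
  fixes g :: "'a::field poly"
  assumes "g \<noteq> 0"
  shows "finite {P\<in>monic_irreducibles. P dvd g}" "card {P\<in>monic_irreducibles. P dvd g} \<le> degree g"
proof -
  have le: "card S \<le> degree g" if "finite S" "S \<subseteq> {P\<in>monic_irreducibles. P dvd g}" for S
  proof -
    have S: "S \<subseteq> monic_irreducibles" using that by auto
    have "(\<Prod>S) ^ 1 dvd g" using that by (subst prod_power_dvd_iff) auto
    then have "degree (\<Prod>S) \<le> degree g" using assms by (intro dvd_imp_degree_le) auto
    moreover have "(\<Sum>P\<in>S. 1) \<le> (\<Sum>P\<in>S. degree P)"
      using S by (intro sum_mono) (auto dest!: monic_irreducibleD(4) subsetD)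
    ultimately show ?thesis using degree_prod_monic_irreducibles[OF that(1) S] by simp
  qed
  show fin: "finite {P\<in>monic_irreducibles. P dvd g}"
  proof (rule ccontr)
    assume "infinite {P\<in>monic_irreducibles. P dvd g}"
    then obtain S where "S \<subseteq> {P\<in>monic_irreducibles. P dvd g}" "finite S" "card S = Suc (degree g)"
      using infinite_arbitrarily_large by blast
    then show False using le[of S] by simp
  qed
  show "card {P\<in>monic_irreducibles. P dvd g} \<le> degree g" using le[OF fin] by simp
qed

lemma squarefree_iff_irreducible_squares:
  fixes f :: "'a::field poly"
  assumes "f \<noteq> 0"
  shows "squarefree f \<longleftrightarrow> {P\<in>monic_irreducibles. P ^ 2 dvd f} = {}"
proof
  assume "squarefree f"
  then show "{P\<in>monic_irreducibles. P ^ 2 dvd f} = {}"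
    using monic_irreducibleD(5) by (auto simp: squarefree_def)
next
  assume none: "{P\<in>monic_irreducibles. P ^ 2 dvd f} = {}"
  show "squarefree f"
  proof (rule squarefreeI)
    fix x assume x: "x ^ 2 dvd f"
    then have "x \<noteq> 0" using assms by auto
    have "\<not> 0 < degree x"
    proof
      assume "0 < degree x"
      then obtain P where "P \<in> monic_irreducibles" "P dvd x" by (rule exists_monic_irreducible_divisor)
      then show False using none x by (auto dest: dvd_power_same[of P x 2] dvd_trans)
    qed
    then show "is_unit x" using \<open>x \<noteq> 0\<close> by (simp add: is_unit_iff_degree)
  qed
qed

lemma sum_Pow_split:
  fixes h :: "'b set \<Rightarrow> 'c::comm_monoid_add"
  assumes "finite R" "x \<in> R"
  shows "(\<Sum>S\<in>Pow R. h S) = (\<Sum>S\<in>Pow (R - {x}). h S + h (insert x S))"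
proof -
  have "Pow R = Pow (R - {x}) \<union> insert x ` Pow (R - {x})"
    using Pow_insert[of x "R - {x}"] assms by (simp add: insert_absorb)
  moreover have "Pow (R - {x}) \<inter> insert x ` Pow (R - {x}) = {}" by auto
  moreover have "inj_on (insert x) (Pow (R - {x}))" by (auto simp: inj_on_def)
  ultimately show ?thesis
    using assms by (simp add: sum.union_disjoint sum.reindex sum.distrib)
qed

lemma alternating_sum_Pow:
  assumes "finite R" "R \<noteq> {}"
  shows "(\<Sum>S\<in>Pow R. (-1) ^ card S) = (0 :: real)"
proof -
  obtain x where x: "x \<in> R" using assms by blast
  have "(-1) ^ card S + (-1) ^ card (insert x S) = (0 :: real)" if "S \<in> Pow (R - {x})" for S
  proof -
    have "finite S" "x \<notin> S" using that assms(1) finite_subset by auto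
    then show ?thesis by simp
  qed
  then show ?thesis by (simp add: sum_Pow_split[OF assms(1) x])
qed

text \<open>
  Pair each \<open>S\<close> that does not contain \<open>x\<close> with \<open>S \<union> {x}\<close>. The two signs cancel, unless the weight bound \<open>D\<close> separates
  the pair. A separated pair has \<open>w(S \<union> {x})\<close> in \<open>(D, D + w x]\<close>, which lies in \<open>(D, 2D]\<close>.
\<close>
lemma truncated_alternating_sum_le:
  fixes w :: "'b \<Rightarrow> nat"
  assumes R: "finite R" and x: "x \<in> R" "w x \<le> D"
  shows "\<bar>\<Sum>S\<in>{S\<in>Pow R. sum w S \<le> D}. (-1) ^ card S\<bar>
    \<le> real (card {S\<in>Pow R. D < sum w S \<and> sum w S \<le> 2 * D})"
proof -
  define h where "h S = (if sum w S \<le> D then (-1) ^ card S else 0 :: real)" for S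
  define W where "W = {S\<in>Pow (R - {x}). sum w S \<le> D \<and> D < sum w (insert x S)}"
  have fin: "finite S" "x \<notin> S" if "S \<in> Pow (R - {x})" for S using that R finite_subset by auto
  have "(\<Sum>S\<in>{S\<in>Pow R. sum w S \<le> D}. (-1) ^ card S) = (\<Sum>S\<in>Pow R. h S)"
    unfolding h_def using R by (simp add: sum.If_cases Int_def)
  also have "\<dots> = (\<Sum>S\<in>Pow (R - {x}). h S + h (insert x S))" by (rule sum_Pow_split[OF R x(1)])
  finally have "\<bar>\<Sum>S\<in>{S\<in>Pow R. sum w S \<le> D}. (-1) ^ card S\<bar>
      \<le> (\<Sum>S\<in>Pow (R - {x}). \<bar>h S + h (insert x S)\<bar>)"
    by (simp add: sum_abs)
  also have "\<dots> \<le> (\<Sum>S\<in>Pow (R - {x}). of_bool (S \<in> W))"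
  proof (rule sum_mono)
    fix S assume "S \<in> Pow (R - {x})"
    then show "\<bar>h S + h (insert x S)\<bar> \<le> of_bool (S \<in> W)"
      using fin[of S] by (auto simp: h_def W_def)
  qed
  also have "\<dots> = real (card W)"
    using R by (simp add: of_bool_def sum.If_cases W_def Int_def)
  also have "card W \<le> card {S\<in>Pow R. D < sum w S \<and> sum w S \<le> 2 * D}"
  proof (rule card_inj_on_le[of "insert x"])
    show "inj_on (insert x) W" by (auto simp: inj_on_def W_def)
    show "insert x ` W \<subseteq> {S\<in>Pow R. D < sum w S \<and> sum w S \<le> 2 * D}"
      using x fin by (auto simp: W_def)
  qed (use R in simp)
  finally show ?thesis by simp
qed

text \<open>
  If \<open>R\<close> has an element of weight at most \<open>D\<close>, the cancellation above applies. If \<open>R\<close> is nonempty and all its weights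
  exceed \<open>D\<close>, only \<open>S = {}\<close> survives the truncation, and the last term pays for it.
\<close>
lemma truncated_squarefree_indicator:
  fixes w :: "'b \<Rightarrow> nat"
  assumes R: "finite R"
  shows "\<bar>of_bool (R = {}) - (\<Sum>S\<in>{S\<in>Pow R. sum w S \<le> D}. (-1) ^ card S)\<bar>
    \<le> real (card {S\<in>Pow R. D < sum w S \<and> sum w S \<le> 2 * D}) + of_bool (\<exists>x\<in>R. D < w x)"
proof (cases "R = {}")
  case True
  then have "{S\<in>Pow R. sum w S \<le> D} = {{}}" by auto
  then show ?thesis using True by simp
next
  case False
  show ?thesis
  proof (cases "\<exists>x\<in>R. w x \<le> D")
    case True
    then show ?thesis using truncated_alternating_sum_le[OF R, of _ w D] False by force
  next
    case large: False
    have "S = {}" if S: "S \<subseteq> R" "sum w S \<le> D" for S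
    proof (rule ccontr)
      assume "S \<noteq> {}"
      then obtain x where "x \<in> S" by blast
      then have "w x \<le> sum w S" using S R by (intro member_le_sum) (auto intro: finite_subset)
      then show False using large S \<open>x \<in> S\<close> by fastforce
    qed
    then have "{S\<in>Pow R. sum w S \<le> D} = {{}}" by auto
    moreover have "\<exists>x\<in>R. D < w x" using False large by (meson all_not_in_conv not_le)
    ultimately show ?thesis using False by simp
  qed
qed

section \<open>Squares of irreducibles of large degree\<close>

text \<open>
  The Frobenius map is injective, hence surjective on a finite field.
\<close>
lemma exists_CHAR_root:
  fixes c :: "'a::finite_field"
  obtains r where "r ^ CHAR('a) = c"
proof -
  have "inj (\<lambda>x::'a. x ^ CHAR('a))"
  proof (rule injI)
    fix x y :: 'a assume eq: "x ^ CHAR('a) = y ^ CHAR('a)"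
    have "(x - y + y) ^ CHAR('a) = (x - y) ^ CHAR('a) + y ^ CHAR('a)"
      by (rule freshmans_dream) auto
    then have "(x - y) ^ CHAR('a) = 0" using eq by simp
    then show "x = y" by simp
  qed
  then have "surj (\<lambda>x::'a. x ^ CHAR('a))" by (rule finite_UNIV_inj_surj[OF finite])
  then show ?thesis using that by (metis surjD)
qed

lemma CHAR_power_decomposition:
  fixes h :: "'a::finite_field poly"
  assumes supp: "\<And>i. coeff h i \<noteq> 0 \<Longrightarrow> \<exists>j<D. i = CHAR('a) * j"
  obtains u where "h = u ^ CHAR('a)" "u = 0 \<or> degree u < D"
proof -
  define p where "p = CHAR('a)"
  have p: "prime p" "p > 0" by (simp_all add: p_def)
  obtain r where r: "\<And>c. r c ^ p = (c :: 'a)" using exists_CHAR_root unfolding p_def by metis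
  define u where "u = (\<Sum>j<D. monom (r (coeff h (p * j))) j)"
  have "u ^ p = (\<Sum>j<D. monom (r (coeff h (p * j))) j ^ p)"
    unfolding u_def by (rule freshmans_dream_sum) (auto simp: p_def)
  also have "\<dots> = (\<Sum>j<D. monom (coeff h (p * j)) (p * j))"
    by (simp add: monom_power r mult.commute)
  also have "\<dots> = h"
  proof (rule poly_eqI)
    fix i
    show "coeff (\<Sum>j<D. monom (coeff h (p * j)) (p * j)) i = coeff h i"
    proof (cases "\<exists>j<D. i = p * j")
      case True
      then obtain j where j: "j < D" "i = p * j" by blast
      have "coeff (\<Sum>j<D. monom (coeff h (p * j)) (p * j)) i = (\<Sum>j'<D. if j' = j then coeff h (p * j) else 0)"
        unfolding coeff_sum using p j by (intro sum.cong) auto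
      then show ?thesis using j by simp
    next
      case False
      then have "coeff h i = 0" using supp unfolding p_def by blast
      moreover have "coeff (\<Sum>j<D. monom (coeff h (p * j)) (p * j)) i = 0"
        unfolding coeff_sum using False by (intro sum.neutral) auto
      ultimately show ?thesis by simp
    qed
  qed
  finally have "h = u ^ p" by simp
  moreover have "u = 0 \<or> degree u < D"
  proof (cases "u = 0")
    case False
    have "coeff u (degree u) = 0" if "D \<le> degree u"
      using that by (simp add: u_def coeff_sum)
    then show ?thesis using False by (metis leading_coeff_0_iff not_le)
  qed simp
  ultimately show ?thesis using that unfolding p_def by blast
qed

text \<open>
  The derivative can only vanish if \<open>a\<^sub>i = 0\<close> for the \<open>D\<close> indices \<open>i = 1 + p j\<close>, \<open>j < D\<close>. Each of these conditions
  costs a factor of at least \<open>2\<close>.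
\<close>
lemma card_pderiv_zero_le:
  fixes A :: "nat \<Rightarrow> 'a::finite_field set"
  assumes A: "\<And>i. i < n \<Longrightarrow> 2 \<le> card (A i)" and D: "CHAR('a) * D \<le> n"
  shows "card {f\<in>restricted_polys n A. pderiv f = 0} * 2 ^ D \<le> (\<Prod>i<n. card (A i))"
proof -
  define p where "p = CHAR('a)"
  have p2: "p \<ge> 2" using prime_ge_2_nat[OF CHAR_prime[where ?'a = 'a]] by (simp add: p_def)
  define I where "I = (\<lambda>j. 1 + p * j) ` {..<D}"
  have cardI: "card I = D" unfolding I_def using p2 by (subst card_image) (auto simp: inj_on_def)
  have I: "I \<subseteq> {..<n}"
  proof
    fix i assume "i \<in> I"
    then obtain j where j: "j < D" "i = 1 + p * j" by (auto simp: I_def)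
    have "p * Suc j \<le> p * D" using j by (intro mult_le_mono2) simp
    then show "i \<in> {..<n}" using j p2 D by (simp add: p_def)
  qed
  define A' where "A' i = (if i \<in> I then A i \<inter> {0} else A i)" for i
  have "{f\<in>restricted_polys n A. pderiv f = 0} \<subseteq> restricted_polys n A'"
  proof
    fix f assume f: "f \<in> {f\<in>restricted_polys n A. pderiv f = 0}"
    have "coeff f i = 0" if "i \<in> I" for i
    proof -
      from that obtain j where j: "i = Suc (p * j)" by (auto simp: I_def)
      have "coeff (pderiv f) (p * j) = 0" using f by simp
      then show ?thesis by (simp add: coeff_pderiv j p_def)
    qed
    then show "f \<in> restricted_polys n A'" using f by (auto simp: restricted_polys_def A'_def)
  qed
  then have "card {f\<in>restricted_polys n A. pderiv f = 0} \<le> (\<Prod>i<n. card (A' i))"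
    using card_mono[OF finite_restricted_polys] by (metis card_restricted_polys)
  then have "card {f\<in>restricted_polys n A. pderiv f = 0} * 2 ^ D \<le> (\<Prod>i<n. card (A' i)) * 2 ^ card I"
    by (simp add: cardI)
  also have "2 ^ card I = (\<Prod>i<n. if i \<in> I then 2 else 1 :: nat)"
    using I by (subst prod.If_cases) (auto simp: Int_absorb1)
  also have "(\<Prod>i<n. card (A' i)) * \<dots> = (\<Prod>i<n. card (A' i) * (if i \<in> I then 2 else 1))"
    by (rule prod.distrib[symmetric])
  also have "\<dots> \<le> (\<Prod>i<n. card (A i))"
  proof (rule prod_mono)
    fix i assume "i \<in> {..<n}"
    moreover have "card (A i \<inter> {0}) \<le> 1" using card_mono[of "{0}" "A i \<inter> {0}"] by simp
    ultimately show "0 \<le> card (A' i) * (if i \<in> I then 2 else 1) \<and>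
        card (A' i) * (if i \<in> I then 2 else 1) \<le> card (A i)"
      using A[of i] by (auto simp: A'_def)
  qed
  finally show ?thesis .
qed

text \<open>
  All elements of \<open>F\<close> have the same nonzero derivative \<open>g\<close>. If \<open>Q\<^sup>2\<close> divides \<open>f\<close>, then \<open>Q\<close> divides \<open>g\<close>, so at most
  \<open>deg g\<close> irreducibles \<open>Q\<close> occur. One \<open>Q\<close> cannot serve two members of \<open>F\<close>: the difference of two of them is
  \<open>u^p\<close> with \<open>u \<noteq> 0\<close> and \<open>deg u < D\<close>, and \<open>Q\<close>, of degree above \<open>D\<close>, would divide \<open>u\<close>.
\<close>
lemma card_large_square_slice_le:
  fixes A :: "nat \<Rightarrow> 'a::finite_field set"
  assumes F: "F \<subseteq> {f\<in>restricted_polys n A. pderiv f \<noteq> 0 \<and>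
      (\<exists>P\<in>monic_irreducibles. D < degree P \<and> P ^ 2 dvd f)}"
    and slice: "\<And>f g i. f \<in> F \<Longrightarrow> g \<in> F \<Longrightarrow> coeff f i \<noteq> coeff g i \<Longrightarrow> \<exists>j<D. i = CHAR('a) * j"
  shows "card F \<le> n"
proof (cases "F = {}")
  case False
  then obtain f0 where f0: "f0 \<in> F" by blast
  define g where "g = pderiv f0"
  have g0: "g \<noteq> 0" using f0 F by (auto simp: g_def)
  have pderiv: "pderiv f = g" if "f \<in> F" for f
  proof (rule poly_eqI)
    fix i
    show "coeff (pderiv f) i = coeff g i"
    proof (cases "coeff f (Suc i) = coeff f0 (Suc i)")
      case False
      with slice[OF that f0, of "Suc i"] obtain j where "Suc i = CHAR('a) * j" by blast
      then have "of_nat (Suc i) = (0::'a)" by (simp only: of_nat_mult of_nat_CHAR mult_zero_left)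
      then show ?thesis unfolding g_def coeff_pderiv by simp
    qed (simp add: g_def coeff_pderiv)
  qed
  have "\<forall>f\<in>F. \<exists>P\<in>monic_irreducibles. D < degree P \<and> P ^ 2 dvd f" using F by blast
  then obtain Q where Q: "\<And>f. f \<in> F \<Longrightarrow> Q f \<in> monic_irreducibles \<and> D < degree (Q f) \<and> Q f ^ 2 dvd f"
    by metis
  have Q_dvd: "Q f dvd f" if "f \<in> F" for f
    using Q[OF that] by (meson dvd_power dvd_trans zero_less_numeral)
  have "Q f dvd g" if f: "f \<in> F" for f
  proof -
    obtain h where h: "f = Q f ^ 2 * h" using Q[OF f] by (auto elim: dvdE)
    \<comment> \<open>Differentiating \<open>f = Q\<^sup>2 h\<close> leaves one factor \<open>Q\<close>.\<close>
    have "pderiv f = Q f * (Q f * pderiv h + 2 * pderiv (Q f) * h)"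
      by (subst (1) h) (simp add: power2_eq_square pderiv_mult algebra_simps)
    then show ?thesis using pderiv[OF f] by (metis dvd_triv_left)
  qed
  then have sub: "Q ` F \<subseteq> {P\<in>monic_irreducibles. P dvd g}" using Q by auto
  have "inj_on Q F"
  proof (rule inj_onI)
    fix f1 f2 assume f: "f1 \<in> F" "f2 \<in> F" "Q f1 = Q f2"
    have supp: "\<exists>j<D. i = CHAR('a) * j" if "coeff (f1 - f2) i \<noteq> 0" for i
      using slice[OF f(1,2), of i] that by simp
    obtain u where u: "f1 - f2 = u ^ CHAR('a)" "u = 0 \<or> degree u < D"
      using CHAR_power_decomposition[OF supp] by blast
    have "Q f1 dvd u ^ CHAR('a)" using Q_dvd f u(1) by (metis dvd_diff)
    then have "Q f1 dvd u"
      using Q[OF f(1)] monic_irreducibleD(1) prime_elem_dvd_power by blast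
    have "u = 0"
    proof (rule ccontr)
      assume "u \<noteq> 0"
      then have "degree (Q f1) \<le> degree u" using \<open>Q f1 dvd u\<close> by (intro dvd_imp_degree_le)
      then show False using u(2) Q[OF f(1)] \<open>u \<noteq> 0\<close> by simp
    qed
    then show "f1 = f2" using u(1) by (simp add: power_0_left)
  qed
  then have "card F \<le> card {P\<in>monic_irreducibles. P dvd g}"
    by (rule card_inj_on_le) (use sub card_irreducible_divisors_le_degree(1)[OF g0] in auto)
  also have "\<dots> \<le> degree g" using card_irreducible_divisors_le_degree(2)[OF g0] .
  also have "\<dots> \<le> degree f0" unfolding g_def
    by (intro degree_le) (auto simp: coeff_pderiv coeff_eq_0)
  also have "\<dots> = n" using f0 F by (auto simp: restricted_polys_def)
  finally show ?thesis .
qed simp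

text \<open>
  Group the polynomials by their coefficients outside the \<open>D\<close> indices \<open>p j\<close>, \<open>j < D\<close>. Each group has at least \<open>2^D\<close>
  members in all, and at most \<open>n\<close> of them are bad.
\<close>
lemma card_large_square_separable_le:
  fixes A :: "nat \<Rightarrow> 'a::finite_field set"
  assumes A: "\<And>i. i < n \<Longrightarrow> 2 \<le> card (A i)" and D: "CHAR('a) * D \<le> n"
  shows "card {f\<in>restricted_polys n A. pderiv f \<noteq> 0 \<and>
      (\<exists>P\<in>monic_irreducibles. D < degree P \<and> P ^ 2 dvd f)} * 2 ^ D \<le> n * (\<Prod>i<n. card (A i))"
    (is "card ?E * _ \<le> _")
proof -
  define p where "p = CHAR('a)"
  have p2: "p \<ge> 2" using prime_ge_2_nat[OF CHAR_prime[where ?'a = 'a]] by (simp add: p_def)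
  define J where "J = (\<lambda>j. p * j) ` {..<D}"
  have cardJ: "card J = D" unfolding J_def using p2 by (subst card_image) (auto simp: inj_on_def)
  have J: "J \<subseteq> {..<n}"
  proof
    fix i assume "i \<in> J"
    then obtain j where j: "j < D" "i = p * j" by (auto simp: J_def)
    have "p * Suc j \<le> p * D" using j by (intro mult_le_mono2) simp
    then show "i \<in> {..<n}" using j p2 D by (simp add: p_def)
  qed
  define B where "B = PiE ({..<n} - J) A"
  define s where "s f = restrict (coeff f) ({..<n} - J)" for f :: "'a poly"
  have ne: "A i \<noteq> {}" if "i < n" for i using A[OF that] by auto
  have finB: "finite B" by (simp add: B_def finite_PiE)
  have "\<exists>b\<in>B. card (s -` {b} \<inter> ?E) * card B \<ge> card ?E"
  proof (rule pigeonhole_card)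
    show "s \<in> ?E \<rightarrow> B" by (auto simp: s_def B_def restricted_polys_def)
    show "finite ?E" by (rule finite_subset[OF _ finite_restricted_polys]) auto
    show "B \<noteq> {}" using ne by (auto simp: B_def PiE_eq_empty_iff)
  qed (rule finB)
  then obtain b where b: "card (s -` {b} \<inter> ?E) * card B \<ge> card ?E" by blast
  have "card (s -` {b} \<inter> ?E) \<le> n"
  proof (rule card_large_square_slice_le[of _ n A D])
    fix f g i assume fg: "f \<in> s -` {b} \<inter> ?E" "g \<in> s -` {b} \<inter> ?E" and ne: "coeff f i \<noteq> coeff g i"
    have "s f = s g" using fg by simp
    then have "i \<notin> {..<n} - J" using ne unfolding s_def by (metis restrict_apply')
    moreover have "i < n"
    proof (rule ccontr)
      assume "\<not> i < n"
      then have "coeff f i = (if i = n then 1 else 0)" "coeff g i = (if i = n then 1 else 0)"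
        using fg by (auto simp: restricted_polys_def coeff_eq_0)
      then show False using ne by simp
    qed
    ultimately show "\<exists>j<D. i = CHAR('a) * j" by (auto simp: J_def p_def)
  qed auto
  then have "card ?E \<le> n * card B" using b by (meson le_trans mult_le_mono1)
  moreover have "card B * 2 ^ D \<le> (\<Prod>i<n. card (A i))"
  proof -
    have "(\<Prod>i<n. card (A i)) = (\<Prod>i\<in>{..<n} - J. card (A i)) * (\<Prod>i\<in>J. card (A i))"
      using J by (intro prod.subset_diff) auto
    moreover have "(\<Prod>i\<in>J. 2) \<le> (\<Prod>i\<in>J. card (A i))"
      using A J by (intro prod_mono) auto
    ultimately show ?thesis by (simp add: B_def card_PiE cardJ)
  qed
  ultimately have "card ?E * 2 ^ D \<le> n * (card B * 2 ^ D)" 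
    "n * (card B * 2 ^ D) \<le> n * (\<Prod>i<n. card (A i))" by (simp_all flip: mult.assoc)
  then show ?thesis by (rule le_trans)
qed

lemma card_large_square_le:
  fixes A :: "nat \<Rightarrow> 'a::finite_field set"
  assumes A: "\<And>i. i < n \<Longrightarrow> 2 \<le> card (A i)" and D: "CHAR('a) * D \<le> n"
  shows "real (card {f\<in>restricted_polys n A. \<exists>P\<in>monic_irreducibles. D < degree P \<and> P ^ 2 dvd f})
     \<le> (real n + 1) / 2 ^ D * (\<Prod>i<n. real (card (A i)))"
proof -
  let ?E = "{f\<in>restricted_polys n A. \<exists>P\<in>monic_irreducibles. D < degree P \<and> P ^ 2 dvd f}"
  let ?Insep = "{f\<in>restricted_polys n A. pderiv f = 0}"
  let ?Sep = "{f\<in>restricted_polys n A. pderiv f \<noteq> 0 \<and>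
      (\<exists>P\<in>monic_irreducibles. D < degree P \<and> P ^ 2 dvd f)}"
  have fin: "finite ?Insep" "finite ?Sep" by simp_all
  have "card ?E \<le> card (?Insep \<union> ?Sep)" using fin by (intro card_mono) auto
  also have "\<dots> \<le> card ?Insep + card ?Sep" by (rule card_Un_le)
  finally have "card ?E * 2 ^ D \<le> card ?Insep * 2 ^ D + card ?Sep * 2 ^ D"
    by (simp only: distrib_right[symmetric] mult_le_mono1)
  then have "card ?E * 2 ^ D \<le> (\<Prod>i<n. card (A i)) + n * (\<Prod>i<n. card (A i))"
    using add_mono[OF card_pderiv_zero_le[OF A D] card_large_square_separable_le[OF A D]]
    by (rule le_trans)
  then have "real (card ?E * 2 ^ D) \<le> real ((\<Prod>i<n. card (A i)) + n * (\<Prod>i<n. card (A i)))"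
    by (simp only: of_nat_le_iff)
  then show ?thesis by (simp add: field_simps)
qed

section \<open>The Moebius function on polynomials coprime to t\<close>

text \<open>
  These sets correspond to the squarefree monic polynomials of degree \<open>d\<close> coprime to \<open>t\<close>, each given by its set of
  prime factors.
\<close>
definition squarefree_supports :: "nat \<Rightarrow> 'a::field poly set set"
  where "squarefree_supports d =
    {S. finite S \<and> S \<subseteq> monic_irreducibles - {[:0, 1:]} \<and> (\<Sum>P\<in>S. degree P) = d}"

lemma finite_squarefree_supports [simp]: "finite (squarefree_supports d :: 'a::finite_field poly set set)"
  and card_squarefree_supports_le: "card (squarefree_supports d :: 'a poly set set) \<le> CARD('a) ^ d"
proof -
  have inj: "inj_on (\<lambda>S. \<Prod>S) (squarefree_supports d :: 'a poly set set)"
    by (rule inj_on_subset[OF inj_on_prod_monic_irreducibles]) (auto simp: squarefree_supports_def)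
  have sub: "(\<lambda>S. \<Prod>S) ` squarefree_supports d \<subseteq> restricted_polys d (\<lambda>_. UNIV :: 'a set)"
  proof (rule image_subsetI)
    fix S :: "'a poly set" assume "S \<in> squarefree_supports d"
    then have S: "finite S" "S \<subseteq> monic_irreducibles" "(\<Sum>P\<in>S. degree P) = d"
      by (auto simp: squarefree_supports_def)
    show "\<Prod>S \<in> restricted_polys d (\<lambda>_. UNIV)"
      using lead_coeff_prod_monic_irreducibles[OF S(2)] degree_prod_monic_irreducibles[OF S(1,2)] S(3)
      by (simp add: restricted_polys_def)
  qed
  show "finite (squarefree_supports d :: 'a poly set set)"
    using inj_on_finite[OF inj sub] by simp
  show "card (squarefree_supports d :: 'a poly set set) \<le> CARD('a) ^ d"
    using card_inj_on_le[OF inj sub] by (simp add: card_restricted_polys)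
qed

lemma squarefree_supports_0: "squarefree_supports 0 = {{} :: 'a::field poly set}"
proof (rule equalityI; rule subsetI)
  fix S :: "'a poly set" assume "S \<in> squarefree_supports 0"
  then have S: "\<forall>P\<in>S. degree P = 0" "S \<subseteq> monic_irreducibles"
    by (auto simp: squarefree_supports_def)
  have "P \<notin> S" for P using S monic_irreducibleD(4)[of P] by fastforce
  then show "S \<in> {{}}" by blast
next
  fix S :: "'a poly set" assume "S \<in> {{}}"
  then show "S \<in> squarefree_supports 0" by (simp add: squarefree_supports_def)
qed

lemma monic_irreducible_t: "[:0, 1:] \<in> monic_irreducibles"
  using irreducible_linear_field_poly[of 1 0] by (simp add: monic_irreducibles_def)

lemma t_dvd_iff: "[:0, 1:] dvd f \<longleftrightarrow> coeff f 0 = (0 :: 'a::field)"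
  using poly_eq_0_iff_dvd[of f 0] by (simp add: poly_0_coeff_0)

lemma coeff_0_prod_support:
  assumes "S \<in> squarefree_supports d"
  shows "coeff (\<Prod>S) 0 \<noteq> (0 :: 'a::field)"
  using assms monic_irreducible_dvd_prod_iff[OF _ _ monic_irreducible_t, of S]
  unfolding t_dvd_iff[symmetric] squarefree_supports_def by auto

definition monics_prime_to_t :: "nat \<Rightarrow> 'a::field poly set"
  where "monics_prime_to_t n = restricted_polys n (\<lambda>i. if i = 0 then - {0} else UNIV)"

lemma monics_prime_to_t_iff:
  "f \<in> monics_prime_to_t n \<longleftrightarrow> lead_coeff f = 1 \<and> degree f = n \<and> coeff f 0 \<noteq> (0 :: 'a::field)"
  unfolding monics_prime_to_t_def restricted_polys_def by (cases n) auto

lemma card_monics_prime_to_t: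
  "card (monics_prime_to_t 0 :: 'a::finite_field poly set) = 1"
  "card (monics_prime_to_t (Suc n) :: 'a poly set) = (CARD('a) - 1) * CARD('a) ^ n"
proof -
  show "card (monics_prime_to_t 0 :: 'a poly set) = 1"
    by (simp add: monics_prime_to_t_def card_restricted_polys)
  have "card (monics_prime_to_t (Suc n) :: 'a poly set)
      = (\<Prod>i<Suc n. card (if i = 0 then - {0} else UNIV :: 'a set))"
    by (simp add: monics_prime_to_t_def card_restricted_polys)
  also have "\<dots> = card (- {0 :: 'a}) * (\<Prod>i<n. CARD('a))"
    by (subst prod.lessThan_Suc_shift) simp
  also have "card (- {0 :: 'a}) = CARD('a) - 1"
    by (simp add: Compl_eq_Diff_UNIV card_Diff_singleton)
  finally show "card (monics_prime_to_t (Suc n) :: 'a poly set) = (CARD('a) - 1) * CARD('a) ^ n" by simp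
qed

lemma card_multiples_monics_prime_to_t:
  fixes g :: "'a::field poly"
  assumes g: "g \<in> monics_prime_to_t d" and "d \<le> n"
  shows "card {f\<in>monics_prime_to_t n. g dvd f} = card (monics_prime_to_t (n - d) :: 'a poly set)"
proof -
  have g': "lead_coeff g = 1" "degree g = d" "coeff g 0 \<noteq> 0" and g0: "g \<noteq> 0"
    using g by (auto simp: monics_prime_to_t_iff)
  have mult: "lead_coeff (g * h) = lead_coeff h" "coeff (g * h) 0 = coeff g 0 * coeff h 0"
    "h \<noteq> 0 \<Longrightarrow> degree (g * h) = d + degree h" for h
    using g' g0 lead_coeff_mult[of g h] by (simp_all add: degree_mult_eq coeff_mult)
  have "(\<lambda>h. g * h) ` monics_prime_to_t (n - d) = {f\<in>monics_prime_to_t n. g dvd f}"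
  proof (intro equalityI image_subsetI subsetI)
    fix h :: "'a poly" assume h: "h \<in> monics_prime_to_t (n - d)"
    then have "h \<noteq> 0" by (auto simp: monics_prime_to_t_iff)
    then show "g * h \<in> {f\<in>monics_prime_to_t n. g dvd f}"
      using mult[of h] g' h \<open>d \<le> n\<close> unfolding monics_prime_to_t_iff by auto
  next
    fix f assume "f \<in> {f\<in>monics_prime_to_t n. g dvd f}"
    then obtain h where f: "f \<in> monics_prime_to_t n" and h: "f = g * h" by (auto elim: dvdE)
    have "f \<noteq> 0" using f by (auto simp: monics_prime_to_t_iff)
    then have "h \<noteq> 0" using h by auto
    then have "h \<in> monics_prime_to_t (n - d)"
      using mult[of h] f unfolding monics_prime_to_t_iff h by auto
    then show "f \<in> (\<lambda>h. g * h) ` monics_prime_to_t (n - d)" using h by blast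
  qed
  moreover have "inj_on (\<lambda>h. g * h) (monics_prime_to_t (n - d))" using g0 by (auto simp: inj_on_def)
  ultimately show ?thesis by (metis card_image)
qed

text \<open>
  The sum of the Moebius function over the monic polynomials of degree \<open>d\<close> coprime to \<open>t\<close>; its nonzero terms come
  from the squarefree ones.
\<close>
definition moebius_sum :: "'a::field itself \<Rightarrow> nat \<Rightarrow> real"
  where "moebius_sum _ d = (\<Sum>S\<in>(squarefree_supports d :: 'a poly set set). (-1) ^ card S)"

text \<open>
  Sum the identity \<open>\<Sum>\<mu>(g) = 0\<close>, with \<open>g\<close> running over the divisors of \<open>f\<close>, over all monic \<open>f\<close> of degree \<open>n\<close> coprime
  to \<open>t\<close>, and count the multiples of each \<open>g\<close>.
\<close>
lemma moebius_sum_convolution: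
  assumes "0 < n"
  shows "(\<Sum>d\<le>n. moebius_sum TYPE('a::finite_field) d *
           real (card (monics_prime_to_t (n - d) :: 'a poly set))) = 0"
proof -
  define T where "T = (monics_prime_to_t n :: 'a poly set)"
  have finT: "finite T" by (simp add: T_def monics_prime_to_t_def)
  have inner: "(\<Sum>d\<le>n. \<Sum>S\<in>{S\<in>squarefree_supports d. \<Prod>S dvd f}. (-1) ^ card S) = (0 :: real)"
    if f: "f \<in> T" for f
  proof -
    define R where "R = {P\<in>monic_irreducibles. P dvd f}"
    have f': "lead_coeff f = 1" "degree f = n" "coeff f 0 \<noteq> 0"
      using f by (auto simp: T_def monics_prime_to_t_iff)
    then have f0: "f \<noteq> 0" by auto
    have finR: "finite R" unfolding R_def by (rule card_irreducible_divisors_le_degree(1)[OF f0])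
    have "R \<noteq> {}" unfolding R_def using f'(2) assms by (metis (mono_tags, lifting) empty_iff exists_monic_irreducible_divisor mem_Collect_eq)
    have tR: "[:0, 1:] \<notin> R" using f'(3) by (simp add: R_def t_dvd_iff)
    have eq: "Pow R = (\<Union>d\<le>n. {S\<in>squarefree_supports d. \<Prod>S dvd f})"
    proof (intro equalityI subsetI)
      fix S assume "S \<in> Pow R"
      then have S: "finite S" "S \<subseteq> monic_irreducibles" "S \<subseteq> R"
        using finR finite_subset by (auto simp: R_def)
      have "\<Prod>S dvd f" using prod_power_dvd_iff[OF S(1,2), of 1 f] S(3) by (auto simp: R_def)
      then have "degree (\<Prod>S) \<le> n" using f0 f'(2) dvd_imp_degree_le by blast
      then show "S \<in> (\<Union>d\<le>n. {S\<in>squarefree_supports d. \<Prod>S dvd f})"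
        using S tR \<open>\<Prod>S dvd f\<close> degree_prod_monic_irreducibles[OF S(1,2)]
        by (auto simp: squarefree_supports_def)
    next
      fix S assume "S \<in> (\<Union>d\<le>n. {S\<in>squarefree_supports d. \<Prod>S dvd f})"
      then have S: "finite S" "S \<subseteq> monic_irreducibles" "\<Prod>S dvd f" by (auto simp: squarefree_supports_def)
      then show "S \<in> Pow R" using prod_power_dvd_iff[OF S(1,2), of 1 f] by (auto simp: R_def)
    qed
    have "(\<Sum>S\<in>Pow R. (-1) ^ card S)
        = (\<Sum>d\<le>n. \<Sum>S\<in>{S\<in>squarefree_supports d. \<Prod>S dvd f}. (-1) ^ card S :: real)"
      unfolding eq
    proof (rule sum.UNION_disjoint)
      show "\<forall>d\<in>{..n}. finite {S\<in>squarefree_supports d. \<Prod>S dvd f}" by simp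
      show "\<forall>d\<in>{..n}. \<forall>d'\<in>{..n}. d \<noteq> d' \<longrightarrow>
          {S\<in>squarefree_supports d. \<Prod>S dvd f} \<inter> {S\<in>squarefree_supports d'. \<Prod>S dvd f} = {}"
        by (auto simp: squarefree_supports_def)
    qed simp
    then show ?thesis using alternating_sum_Pow[OF finR \<open>R \<noteq> {}\<close>] by simp
  qed
  have "0 = (\<Sum>f\<in>T. \<Sum>d\<le>n. \<Sum>S\<in>{S\<in>squarefree_supports d. \<Prod>S dvd f}. (-1) ^ card S :: real)"
    by (simp add: inner)
  also have "\<dots> = (\<Sum>d\<le>n. \<Sum>f\<in>T. \<Sum>S\<in>squarefree_supports d. (-1) ^ card S * of_bool (\<Prod>S dvd f))"
    by (subst sum.swap) (simp add: of_bool_def if_distrib sum.If_cases Int_def cong: if_cong)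
  also have "\<dots> = (\<Sum>d\<le>n. moebius_sum TYPE('a) d * real (card (monics_prime_to_t (n - d) :: 'a poly set)))"
  proof (intro sum.cong refl)
    fix d assume d: "d \<in> {..n}"
    have "(\<Sum>f\<in>T. \<Sum>S\<in>squarefree_supports d. (-1) ^ card S * of_bool (\<Prod>S dvd f))
        = (\<Sum>S\<in>squarefree_supports d. (-1) ^ card S * (\<Sum>f\<in>T. of_bool (\<Prod>S dvd f) :: real))"
      by (subst sum.swap) (simp add: sum_distrib_left)
    also have "\<dots> = (\<Sum>S\<in>(squarefree_supports d :: 'a poly set set). (-1) ^ card S *
        real (card (monics_prime_to_t (n - d) :: 'a poly set)))"
    proof (rule sum.cong[OF refl])
      fix S :: "'a poly set" assume Sd: "S \<in> squarefree_supports d"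
      then have S: "finite S" "S \<subseteq> monic_irreducibles" "(\<Sum>P\<in>S. degree P) = d"
        by (auto simp: squarefree_supports_def)
      have "\<Prod>S \<in> monics_prime_to_t d"
        using lead_coeff_prod_monic_irreducibles[OF S(2)] degree_prod_monic_irreducibles[OF S(1,2)] S(3)
          coeff_0_prod_support[OF Sd] by (simp add: monics_prime_to_t_iff)
      then have "card {f\<in>T. \<Prod>S dvd f} = card (monics_prime_to_t (n - d) :: 'a poly set)"
        unfolding T_def using d by (intro card_multiples_monics_prime_to_t) auto
      then show "(-1) ^ card S * (\<Sum>f\<in>T. of_bool (\<Prod>S dvd f))
          = (-1) ^ card S * real (card (monics_prime_to_t (n - d) :: 'a poly set))"
        using finT by (simp add: of_bool_def sum.If_cases Int_def)
    qed
    finally show "(\<Sum>f\<in>T. \<Sum>S\<in>squarefree_supports d. (-1) ^ card S * of_bool (\<Prod>S dvd f))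
        = moebius_sum TYPE('a) d * real (card (monics_prime_to_t (n - d) :: 'a poly set))"
      by (simp add: moebius_sum_def sum_distrib_right)
  qed
  finally show ?thesis by simp
qed

lemma moebius_sum_0: "moebius_sum TYPE('a::field) 0 = 1"
  by (simp add: moebius_sum_def squarefree_supports_0)

text \<open>
  In terms of generating functions, the convolution identity says
  \<open>(\<Sum>\<mu>\<^sub>d x^d) (1 - x) / (1 - q x) = 1\<close>, so that \<open>\<Sum>\<mu>\<^sub>d x^d = (1 - q x) / (1 - x)\<close>.
\<close>
lemma moebius_sum_pos:
  assumes "0 < d"
  shows "moebius_sum TYPE('a::finite_field) d = 1 - real CARD('a)"
proof -
  define q where "q = real CARD('a)"
  define c where "c n = real (card (monics_prime_to_t n :: 'a poly set))" for n
  define \<mu> where "\<mu> = moebius_sum TYPE('a)"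
  have "CARD('a) \<ge> 1" by (simp add: Suc_leI)
  then have c: "c 0 = 1" "c (Suc n) = (q - 1) * q ^ n" for n
    by (simp_all add: c_def card_monics_prime_to_t q_def of_nat_diff)
  have conv: "(\<Sum>d\<le>n. \<mu> d * c (n - d)) = 0" if "0 < n" for n
    unfolding \<mu>_def c_def by (rule moebius_sum_convolution[OF that])
  have c_rec: "c (Suc n - d) = q * c (n - d)" if "d < n" for n d
  proof -
    define m where "m = n - d - 1"
    have "n - d = Suc m" "Suc n - d = Suc (Suc m)" using that by (simp_all add: m_def)
    then show ?thesis by (simp only: c(2) power_Suc mult_ac)
  qed
  \<comment> \<open>Subtract \<open>q\<close> times the identity for \<open>n\<close> from the one for \<open>n + 1\<close>; the counts \<open>c\<close> grow by the factor \<open>q\<close>, so only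
      the last terms survive.\<close>
  have step: "\<mu> (Suc n) = \<mu> n" if n: "0 < n" for n
  proof -
    have "(\<Sum>d\<le>Suc n. \<mu> d * c (Suc n - d)) = (\<Sum>d<n. \<mu> d * c (Suc n - d)) + \<mu> n * c 1 + \<mu> (Suc n) * c 0"
      by (simp flip: lessThan_Suc_atMost)
    also have "(\<Sum>d<n. \<mu> d * c (Suc n - d)) = q * (\<Sum>d<n. \<mu> d * c (n - d))"
      by (simp add: sum_distrib_left c_rec mult_ac)
    also have "(\<Sum>d<n. \<mu> d * c (n - d)) = - \<mu> n"
      using conv[OF n] c(1) by (simp flip: lessThan_Suc_atMost)
    finally show ?thesis using conv[of "Suc n"] c(1) c(2)[of 0] by (simp add: algebra_simps)
  qed
  have "\<mu> (Suc n) = 1 - q" for n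
  proof (induction n)
    case 0
    show ?case using conv[of 1] c(1) c(2)[of 0] moebius_sum_0[where ?'a = 'a] by (simp add: \<mu>_def)
  qed (simp add: step)
  then show ?thesis using assms by (metis \<mu>_def gr0_conv_Suc q_def)
qed

section \<open>The sieve\<close>

text \<open>
  A set \<open>S\<close> of monic irreducibles consists of primes whose squares divide \<open>f\<close> iff the square of its product
  divides \<open>f\<close>. This turns a sum over the subsets of \<open>R\<close>, which depends on \<open>f\<close>, into a sum over a fixed index set, so
  that the order of summation over \<open>f\<close> and \<open>S\<close> can be exchanged.
\<close>
lemma sum_supports_of_square_divisors:
  fixes f :: "'a::finite_field poly"
  assumes f0: "f \<noteq> 0" and t: "\<not> [:0, 1:] ^ 2 dvd f" and I: "finite I"
  defines "R \<equiv> {P\<in>monic_irreducibles. P ^ 2 dvd f}"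
  shows "(\<Sum>S\<in>{S\<in>Pow R. sum degree S \<in> I}. h S) =
    (\<Sum>d\<in>I. \<Sum>S\<in>squarefree_supports d. h S * of_bool ((\<Prod>S) ^ 2 dvd f) :: real)"
proof -
  have finR: "finite R"
    by (rule finite_subset[OF _ card_irreducible_divisors_le_degree(1)[OF f0]])
      (auto simp: R_def intro: dvd_trans[OF dvd_power])
  have eq: "{S\<in>Pow R. sum degree S \<in> I} = (\<Union>d\<in>I. {S\<in>squarefree_supports d. (\<Prod>S) ^ 2 dvd f})"
  proof (rule equalityI; rule subsetI)
    fix S assume S: "S \<in> {S\<in>Pow R. sum degree S \<in> I}"
    then have S': "finite S" "S \<subseteq> monic_irreducibles" using finR finite_subset by (auto simp: R_def)
    have "[:0, 1:] \<notin> S" using S t by (auto simp: R_def)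
    then have "S \<in> squarefree_supports (sum degree S)" using S' by (auto simp: squarefree_supports_def)
    moreover have "(\<Prod>S) ^ 2 dvd f" using S prod_power_dvd_iff[OF S'] by (auto simp: R_def)
    ultimately show "S \<in> (\<Union>d\<in>I. {S\<in>squarefree_supports d. (\<Prod>S) ^ 2 dvd f})" using S by blast
  next
    fix S assume S: "S \<in> (\<Union>d\<in>I. {S\<in>squarefree_supports d. (\<Prod>S) ^ 2 dvd f})"
    then have S': "finite S" "S \<subseteq> monic_irreducibles" "sum degree S \<in> I" "(\<Prod>S) ^ 2 dvd f"
      by (auto simp: squarefree_supports_def)
    then show "S \<in> {S\<in>Pow R. sum degree S \<in> I}" 
      using prod_power_dvd_iff[OF S'(1,2)] by (auto simp: R_def)
  qed
  have "(\<Sum>S\<in>{S\<in>Pow R. sum degree S \<in> I}. h S)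
      = (\<Sum>d\<in>I. \<Sum>S\<in>{S\<in>squarefree_supports d. (\<Prod>S) ^ 2 dvd f}. h S)"
    unfolding eq by (rule sum.UNION_disjoint[OF I]) (simp, force simp: squarefree_supports_def)
  also have "\<dots> = (\<Sum>d\<in>I. \<Sum>S\<in>squarefree_supports d. h S * of_bool ((\<Prod>S) ^ 2 dvd f))"
    by (simp add: sum.inter_filter of_bool_def if_distrib cong: if_cong)
  finally show ?thesis .
qed

text \<open>
  The truncated inclusion-exclusion for a single polynomial, summed over all polynomials in \<open>X\<close>.
\<close>
lemma sieve_inequality:
  fixes X :: "'a::finite_field poly set"
  assumes X: "finite X" "\<And>f. f \<in> X \<Longrightarrow> f \<noteq> 0" "\<And>f. f \<in> X \<Longrightarrow> \<not> [:0, 1:] ^ 2 dvd f"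
  defines "N \<equiv> \<lambda>S. real (card {f\<in>X. (\<Prod>S) ^ 2 dvd f})"
  shows "\<bar>real (card {f\<in>X. squarefree f}) - (\<Sum>d\<le>D. \<Sum>S\<in>squarefree_supports d. (-1) ^ card S * N S)\<bar>
    \<le> (\<Sum>d\<in>{D<..2*D}. \<Sum>S\<in>squarefree_supports d. N S)
      + real (card {f\<in>X. \<exists>P\<in>monic_irreducibles. D < degree P \<and> P ^ 2 dvd f})"
proof -
  define R where "R f = {P\<in>monic_irreducibles. P ^ 2 dvd f}" for f :: "'a poly"
  have finR: "finite (R f)" if "f \<in> X" for f
    by (rule finite_subset[OF _ card_irreducible_divisors_le_degree(1)[OF X(2)[OF that]]])
      (auto simp: R_def intro: dvd_trans[OF dvd_power])
  have swap: "(\<Sum>f\<in>X. \<Sum>S\<in>{S\<in>Pow (R f). sum degree S \<in> I}. h S)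
      = (\<Sum>d\<in>I. \<Sum>S\<in>squarefree_supports d. h S * N S)" if "finite I" for I h
  proof -
    have "(\<Sum>f\<in>X. \<Sum>S\<in>{S\<in>Pow (R f). sum degree S \<in> I}. h S)
        = (\<Sum>f\<in>X. \<Sum>d\<in>I. \<Sum>S\<in>squarefree_supports d. h S * of_bool ((\<Prod>S) ^ 2 dvd f))"
      unfolding R_def by (intro sum.cong refl sum_supports_of_square_divisors X that)
    also have "\<dots> = (\<Sum>d\<in>I. \<Sum>S\<in>squarefree_supports d. \<Sum>f\<in>X. h S * of_bool ((\<Prod>S) ^ 2 dvd f))"
      by (subst sum.swap, intro sum.cong refl sum.swap)
    also have "\<dots> = (\<Sum>d\<in>I. \<Sum>S\<in>squarefree_supports d. h S * N S)"
      using X(1) by (simp add: N_def sum_distrib_left[symmetric] of_bool_def sum.If_cases Int_def)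
    finally show ?thesis .
  qed
  have sqf: "real (card {f\<in>X. squarefree f}) = (\<Sum>f\<in>X. of_bool (R f = {}))"
  proof -
    have "{f\<in>X. squarefree f} = X \<inter> {f. R f = {}}"
      using X(2) squarefree_iff_irreducible_squares unfolding R_def by blast
    then show ?thesis using X(1) by (simp add: of_bool_def sum.If_cases)
  qed
  have large: "real (card {f\<in>X. \<exists>P\<in>monic_irreducibles. D < degree P \<and> P ^ 2 dvd f})
      = (\<Sum>f\<in>X. of_bool (\<exists>P\<in>R f. D < degree P))"
  proof -
    have "{f\<in>X. \<exists>P\<in>monic_irreducibles. D < degree P \<and> P ^ 2 dvd f} = X \<inter> {f. \<exists>P\<in>R f. D < degree P}"
      by (auto simp: R_def)
    then show ?thesis using X(1) by (simp add: of_bool_def sum.If_cases)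
  qed
  have "\<bar>real (card {f\<in>X. squarefree f}) - (\<Sum>d\<le>D. \<Sum>S\<in>squarefree_supports d. (-1) ^ card S * N S)\<bar>
      = \<bar>\<Sum>f\<in>X. of_bool (R f = {}) - (\<Sum>S\<in>{S\<in>Pow (R f). sum degree S \<in> {..D}}. (-1) ^ card S)\<bar>"
    unfolding sum_subtractf sqf swap[OF finite_atMost] by simp
  also have "\<dots> \<le> (\<Sum>f\<in>X. \<bar>of_bool (R f = {}) - (\<Sum>S\<in>{S\<in>Pow (R f). sum degree S \<in> {..D}}. (-1) ^ card S)\<bar>)"
    by (rule sum_abs)
  also have "\<dots> \<le> (\<Sum>f\<in>X. (\<Sum>S\<in>{S\<in>Pow (R f). sum degree S \<in> {D<..2*D}}. 1) + of_bool (\<exists>P\<in>R f. D < degree P))"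
  proof (rule sum_mono)
    fix f assume "f \<in> X"
    from truncated_squarefree_indicator[OF finR[OF this], of degree D]
    show "\<bar>of_bool (R f = {}) - (\<Sum>S\<in>{S\<in>Pow (R f). sum degree S \<in> {..D}}. (-1) ^ card S)\<bar>
        \<le> (\<Sum>S\<in>{S\<in>Pow (R f). sum degree S \<in> {D<..2*D}}. 1) + (of_bool (\<exists>P\<in>R f. D < degree P) :: real)"
      by simp
  qed
  also have "\<dots> = (\<Sum>d\<in>{D<..2*D}. \<Sum>S\<in>squarefree_supports d. N S) + (\<Sum>f\<in>X. of_bool (\<exists>P\<in>R f. D < degree P))"
    unfolding sum.distrib swap[OF finite_greaterThanAtMost] by simp
  finally show ?thesis unfolding large .
qed

text \<open>
  At infinite level the sum is \<open>(1 - q x) / (1 - x)\<close> for \<open>x = q^(-2)\<close>, the Euler product of \<open>1 - q^(-2 deg P)\<close> over all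
  monic irreducibles \<open>P\<close> other than \<open>t\<close>.
\<close>
lemma truncated_euler_product:
  fixes q :: real
  assumes q: "q = real CARD('a::finite_field)"
  shows "(\<Sum>d\<le>D. moebius_sum TYPE('a) d / q ^ (2 * d)) = 1 / (1 + 1 / q) + 1 / ((q + 1) * q ^ (2 * D))"
proof (induction D)
  case 0
  have "q > 0" using q by simp
  then show ?case by (simp add: moebius_sum_0 field_simps)
next
  case (Suc D)
  have "q > 0" using q by simp
  have "(\<Sum>d\<le>Suc D. moebius_sum TYPE('a) d / q ^ (2 * d))
      = 1 / (1 + 1 / q) + (1 / ((q + 1) * q ^ (2 * D)) + (1 - q) / (q ^ (2 * D) * q ^ 2))"
    using Suc by (simp add: moebius_sum_pos q[symmetric] power_add[symmetric])
  also have "1 / ((q + 1) * q ^ (2 * D)) + (1 - q) / (q ^ (2 * D) * q ^ 2)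
      = 1 / ((q + 1) * (q ^ (2 * D) * q ^ 2))"
    using \<open>q > 0\<close> by (simp add: divide_simps) (simp add: algebra_simps power2_eq_square)
  finally show ?case by (simp add: power_add[symmetric])
qed

text \<open>
  Coefficient sets that single out the multiples of \<open>t\<^sup>2\<close>.
\<close>
definition zero_low_coeff_sets :: "(nat \<Rightarrow> 'a::zero set) \<Rightarrow> nat \<Rightarrow> 'a set"
  where "zero_low_coeff_sets A i = (if i < 2 then A i \<inter> {0} else A i)"

lemma t_sq_dvd_iff: "[:0, 1:] ^ 2 dvd f \<longleftrightarrow> coeff f 0 = 0 \<and> coeff f 1 = (0 :: 'a::field)"
proof
  assume "[:0, 1:] ^ 2 dvd f"
  then obtain h where "f = [:0, 1:] ^ 2 * h" by (elim dvdE)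
  then show "coeff f 0 = 0 \<and> coeff f 1 = 0" by (simp add: power2_eq_square)
next
  assume f: "coeff f 0 = 0 \<and> coeff f 1 = 0"
  obtain a b h where "f = pCons a (pCons b h)" by (metis pCons_cases)
  then have "f = [:0, 1:] ^ 2 * h" using f by (simp add: power2_eq_square)
  then show "[:0, 1:] ^ 2 dvd f" by simp
qed

lemma restricted_polys_zero_low_coeffs:
  assumes "2 \<le> n"
  shows "restricted_polys n (zero_low_coeff_sets A) = {f\<in>restricted_polys n A. [:0, 1:] ^ 2 dvd f}"
proof -
  have "(\<forall>i<n. coeff f i \<in> zero_low_coeff_sets A i) \<longleftrightarrow>
      (\<forall>i<n. coeff f i \<in> A i) \<and> coeff f 0 = 0 \<and> coeff f 1 = 0" for f
  proof -
    have split: "(\<forall>i<n. Q i) \<longleftrightarrow> Q 0 \<and> Q 1 \<and> (\<forall>i<n. 2 \<le> i \<longrightarrow> Q i)" for Q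
    proof -
      have "i = 0 \<or> i = 1 \<or> 2 \<le> i" for i :: nat by linarith
      then show ?thesis using assms by (metis less_le_trans pos2 one_less_numeral_iff semiring_norm(76))
    qed
    show ?thesis
      unfolding split[of "\<lambda>i. coeff f i \<in> zero_low_coeff_sets A i"] split[of "\<lambda>i. coeff f i \<in> A i"]
      by (auto simp: zero_low_coeff_sets_def)
  qed
  then show ?thesis unfolding restricted_polys_def t_sq_dvd_iff by blast
qed

lemma kappa_main_term:
  fixes A :: "nat \<Rightarrow> 'a::finite_field set"
  assumes "2 \<le> n" and A: "\<And>i. i < n \<Longrightarrow> 2 \<le> card (A i)"
  shows "kappa A * (\<Prod>i<n. real (card (A i))) =
    ((\<Prod>i<n. real (card (A i))) - (\<Prod>i<n. real (card (zero_low_coeff_sets A i)))) / (1 + 1 / real CARD('a))"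
proof -
  define m where "m = n - 2"
  have m: "n = Suc (Suc m)" using assms(1) by (simp add: m_def)
  have c: "real (card (S \<inter> {0})) = of_bool (0 \<in> S)" for S :: "'a set" by (cases "0 \<in> S") auto
  have "card (A 0) > 0" "card (A 1) > 0" using A[of 0] A[of 1] m by auto
  moreover have "(\<Prod>i<n. real (card (A i))) = real (card (A 0)) * real (card (A 1)) * (\<Prod>i<m. real (card (A (Suc (Suc i)))))"
    unfolding m by (simp only: prod.lessThan_Suc_shift One_nat_def mult.assoc)
  moreover have "(\<Prod>i<n. real (card (zero_low_coeff_sets A i))) = of_bool (0 \<in> A 0) * of_bool (0 \<in> A 1) * (\<Prod>i<m. real (card (A (Suc (Suc i)))))"
    unfolding m by (simp only: prod.lessThan_Suc_shift One_nat_def mult.assoc) (simp add: zero_low_coeff_sets_def c)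
  ultimately show ?thesis by (simp add: kappa_def divide_simps) (simp add: algebra_simps)
qed

lemma kappa_ge_half:
  fixes A :: "nat \<Rightarrow> 'a::finite_field set"
  assumes "2 \<le> card (A 0)" "2 \<le> card (A 1)"
  shows "1 / 2 \<le> kappa A"
proof -
  have "{0, 1 :: 'a} \<subseteq> UNIV" by simp
  then have "card {0, 1 :: 'a} \<le> CARD('a)" by (rule card_mono[OF finite])
  then have q: "2 \<le> real CARD('a)" by simp
  define x y where "x = of_bool (0 \<in> A 0) / real (card (A 0))" and "y = of_bool (0 \<in> A 1) / real (card (A 1))"
  have b: "0 \<le> x" "x \<le> 1 / 2" "0 \<le> y" "y \<le> 1 / 2" 
    using assms by (auto simp: x_def y_def field_simps)
  then have "x * y \<le> (1 / 2) * (1 / 2)" by (intro mult_mono) auto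
  then have "3 / 4 \<le> 1 - x * y" by simp
  moreover have "2 / 3 \<le> 1 / (1 + 1 / real CARD('a))" using q by (simp add: field_simps)
  ultimately have "(2 / 3) * (3 / 4) \<le> 1 / (1 + 1 / real CARD('a)) * (1 - x * y)" by (intro mult_mono) auto
  then show ?thesis by (simp add: kappa_def x_def y_def)
qed

context cancelling_character
begin

text \<open>
  The polynomials that are not divisible by \<open>t\<^sup>2\<close> are counted as the difference of two families with prescribed
  coefficient sets. The equidistribution result applies to both, since \<open>(\<Prod>S)\<^sup>2\<close> is coprime to \<open>t\<close> and has degree at
  most \<open>4 D\<close>.
\<close>
lemma card_square_multiples:
  fixes A :: "nat \<Rightarrow> 'a set"
  assumes n: "2 \<le> n" and A: "\<And>i. i < n \<Longrightarrow> affinely_spanning (A i)"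
    and S: "S \<in> squarefree_supports d" and d: "d \<le> 2 * D" and D: "0 < D"
  defines "X \<equiv> {f\<in>restricted_polys n A. \<not> [:0, 1:] ^ 2 dvd f}"
  shows "\<bar>real (card {f\<in>X. (\<Prod>S) ^ 2 dvd f}) -
      ((\<Prod>i<n. real (card (A i))) - (\<Prod>i<n. real (card (zero_low_coeff_sets A i)))) / real CARD('a) ^ (2 * d)\<bar>
    \<le> 2 * (\<Prod>i<n. real (card (A i))) * \<theta> ^ ((n - 2) div (4 * D))"
proof -
  define B where "B = zero_low_coeff_sets A"
  define M where "M = (\<Prod>S) ^ 2"
  define N where "N Z = real (card {f\<in>restricted_polys n Z. M dvd f})" for Z :: "nat \<Rightarrow> 'a set"
  define P where "P Z = (\<Prod>i<n. real (card (Z i)))" for Z :: "nat \<Rightarrow> 'a set"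
  define \<eta> where "\<eta> = \<theta> ^ ((n - 2) div (4 * D))"
  have S': "finite S" "S \<subseteq> monic_irreducibles" "sum degree S = d"
    using S by (auto simp: squarefree_supports_def)
  have M0: "coeff M 0 \<noteq> 0" using coeff_0_prod_support[OF S] by (simp add: M_def power2_eq_square coeff_mult)
  have Mdeg: "degree M = 2 * d"
    using degree_prod_monic_irreducibles[OF S'(1,2)] S'(3) coeff_0_prod_support[OF S]
    by (subst M_def, subst degree_power_eq) auto
  have eq: "\<bar>N Z - P Z / real CARD('a) ^ (2 * d)\<bar> \<le> P Z * \<eta>"
    if "\<And>i. 2 \<le> i \<Longrightarrow> i < n \<Longrightarrow> affinely_spanning (Z i)" for Z
    unfolding N_def P_def \<eta>_def Mdeg[symmetric]
    by (rule equidistribution_mod) (use M0 Mdeg d D that in auto)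
  have "\<bar>N A - P A / real CARD('a) ^ (2 * d)\<bar> \<le> P A * \<eta>" by (rule eq) (use A in auto)
  moreover have "\<bar>N B - P B / real CARD('a) ^ (2 * d)\<bar> \<le> P B * \<eta>"
    by (rule eq) (use A in \<open>auto simp: B_def zero_low_coeff_sets_def\<close>)
  moreover have "P B * \<eta> \<le> P A * \<eta>"
  proof (rule mult_right_mono)
    show "P B \<le> P A" unfolding P_def
      by (intro prod_mono) (auto simp: B_def zero_low_coeff_sets_def card_mono)
    show "0 \<le> \<eta>" using \<theta>_ge by (simp add: \<eta>_def)
  qed
  moreover have "real (card {f\<in>X. M dvd f}) = N A - N B"
  proof -
    have sub: "{f\<in>restricted_polys n B. M dvd f} \<subseteq> {f\<in>restricted_polys n A. M dvd f}"
      unfolding B_def restricted_polys_zero_low_coeffs[OF n] by auto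
    have "{f\<in>X. M dvd f} = {f\<in>restricted_polys n A. M dvd f} - {f\<in>restricted_polys n B. M dvd f}"
      unfolding B_def restricted_polys_zero_low_coeffs[OF n] X_def by auto
    then have "card {f\<in>X. M dvd f} = card {f\<in>restricted_polys n A. M dvd f} - card {f\<in>restricted_polys n B. M dvd f}"
      using sub by (simp add: card_Diff_subset)
    moreover have "card {f\<in>restricted_polys n B. M dvd f} \<le> card {f\<in>restricted_polys n A. M dvd f}"
      using sub by (intro card_mono) auto
    ultimately show ?thesis by (simp add: N_def of_nat_diff)
  qed
  ultimately show ?thesis unfolding M_def P_def B_def \<eta>_def diff_divide_distrib by linarith
qed

end

section \<open>The main estimate for a fixed sieve level\<close>

context cancelling_character
begin

text \<open>
  The factor \<open>(2 D + 1) q^(2 D)\<close> bounds the number of sets \<open>S\<close> to which equidistribution is applied. In the term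
  \<open>(D + 1) / q^D\<close>, the window \<open>(D, 2D]\<close> accounts for \<open>D / q^D\<close> and the tail of the Euler product for \<open>1 / q^D\<close>. The last
  term comes from the irreducibles of degree above \<open>D\<close>.
\<close>
lemma card_squarefree_polys_approx:
  fixes A :: "nat \<Rightarrow> 'a set"
  assumes n: "2 \<le> n" and A: "\<And>i. i < n \<Longrightarrow> affinely_spanning (A i)"
    and D: "0 < D" "CHAR('a) * D \<le> n"
  defines "q \<equiv> real CARD('a)" and "P \<equiv> \<Prod>i<n. real (card (A i))"
  shows "\<bar>real (card (squarefree_polys n A)) - kappa A * P\<bar>
    \<le> P * (2 * \<theta> ^ ((n - 2) div (4 * D)) * ((2 * real D + 1) * q ^ (2 * D))
        + (real D + 1) / q ^ D + (real n + 1) / 2 ^ D)"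
proof -
  define X where "X = {f\<in>restricted_polys n A. \<not> [:0, 1:] ^ 2 dvd f}"
  define N where "N S = real (card {f\<in>X. (\<Prod>S) ^ 2 dvd f})" for S
  define Y where "Y = P - (\<Prod>i<n. real (card (zero_low_coeff_sets A i)))"
  define \<eta> where "\<eta> = \<theta> ^ ((n - 2) div (4 * D))"
  define \<delta> where "\<delta> = 2 * P * \<eta>"
  have cardA: "2 \<le> card (A i)" if "i < n" for i using affinely_spanning_card_ge_2[OF A[OF that]] .
  have q1: "q \<ge> 1" unfolding q_def by (simp add: Suc_leI)
  have P0: "0 \<le> P" unfolding P_def by (intro prod_nonneg) simp
  have \<eta>0: "0 \<le> \<eta>" using \<theta>_ge by (simp add: \<eta>_def)
  have \<delta>0: "0 \<le> \<delta>" using P0 \<eta>0 by (simp add: \<delta>_def)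
  have Y: "0 \<le> Y" "Y \<le> P"
  proof -
    have "(\<Prod>i<n. real (card (zero_low_coeff_sets A i))) \<le> P" unfolding P_def
      by (intro prod_mono) (auto simp: zero_low_coeff_sets_def card_mono)
    moreover have "0 \<le> (\<Prod>i<n. real (card (zero_low_coeff_sets A i)))" by (intro prod_nonneg) simp
    ultimately show "0 \<le> Y" "Y \<le> P" by (simp_all add: Y_def)
  qed
  have cardS: "real (card (squarefree_supports d :: 'a poly set set)) \<le> q ^ d" for d
    using card_squarefree_supports_le[where ?'a = 'a, of d] unfolding q_def
    by (metis of_nat_le_iff of_nat_power)
  have NS: "\<bar>N S - Y / q ^ (2 * d)\<bar> \<le> \<delta>" if "S \<in> squarefree_supports d" "d \<le> 2 * D" for S d
    unfolding N_def X_def Y_def P_def q_def \<delta>_def \<eta>_def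
    by (rule card_square_multiples[OF n A that D(1)])
  have sqf: "squarefree_polys n A = {f\<in>X. squarefree f}"
  proof -
    have "\<not> [:0, 1:] ^ 2 dvd f" if "squarefree f" for f :: "'a poly"
      using squarefreeD[OF that] monic_irreducibleD(5)[OF monic_irreducible_t] by blast
    then show ?thesis by (auto simp: squarefree_polys_def X_def restricted_polys_def)
  qed
  have sieve: "\<bar>real (card (squarefree_polys n A)) - (\<Sum>d\<le>D. \<Sum>S\<in>squarefree_supports d. (-1) ^ card S * N S)\<bar>
      \<le> (\<Sum>d\<in>{D<..2*D}. \<Sum>S\<in>squarefree_supports d. N S)
        + real (card {f\<in>X. \<exists>Q\<in>monic_irreducibles. D < degree Q \<and> Q ^ 2 dvd f})"
    unfolding sqf N_def
  proof (rule sieve_inequality)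
    show "finite X" by (simp add: X_def)
  qed (auto simp: X_def restricted_polys_def)
  have large: "real (card {f\<in>X. \<exists>Q\<in>monic_irreducibles. D < degree Q \<and> Q ^ 2 dvd f}) \<le> (real n + 1) / 2 ^ D * P"
  proof -
    have "card {f\<in>X. \<exists>Q\<in>monic_irreducibles. D < degree Q \<and> Q ^ 2 dvd f}
        \<le> card {f\<in>restricted_polys n A. \<exists>Q\<in>monic_irreducibles. D < degree Q \<and> Q ^ 2 dvd f}"
      by (rule card_mono) (auto simp: X_def)
    then show ?thesis unfolding P_def
      using card_large_square_le[of n A D, OF cardA D(2)] by linarith
  qed
  have tail: "(\<Sum>d\<in>{D<..2*D}. \<Sum>S\<in>squarefree_supports d. N S) \<le> real D * (P / q ^ D) + (\<Sum>d\<in>{D<..2*D}. q ^ d * \<delta>)"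
  proof -
    have "(\<Sum>S\<in>squarefree_supports d. N S) \<le> P / q ^ D + q ^ d * \<delta>" if d: "d \<in> {D<..2*D}" for d
    proof -
      have "(\<Sum>S\<in>squarefree_supports d. N S)
          \<le> (\<Sum>S\<in>(squarefree_supports d :: 'a poly set set). Y / q ^ (2 * d) + \<delta>)"
        using NS[of _ d] d by (intro sum_mono) (auto simp: abs_le_iff diff_le_eq add.commute)
      also have "\<dots> \<le> q ^ d * (Y / q ^ (2 * d) + \<delta>)"
        using cardS[of d] Y(1) q1 \<delta>0 by (simp add: mult_right_mono)
      also have "\<dots> = Y / q ^ d + q ^ d * \<delta>"
        using q1 by (simp add: distrib_left mult_2 power_add)
      also have "Y / q ^ d \<le> P / q ^ D"
        using Y P0 q1 d by (intro frac_le power_increasing) auto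
      finally show ?thesis by simp
    qed
    then have "(\<Sum>d\<in>{D<..2*D}. \<Sum>S\<in>squarefree_supports d. N S) \<le> (\<Sum>d\<in>{D<..2*D}. P / q ^ D + q ^ d * \<delta>)"
      by (rule sum_mono)
    then show ?thesis by (simp add: sum.distrib)
  qed
  have main: "\<bar>(\<Sum>d\<le>D. \<Sum>S\<in>squarefree_supports d. (-1) ^ card S * N S)
      - Y * (\<Sum>d\<le>D. moebius_sum TYPE('a) d / q ^ (2 * d))\<bar> \<le> (\<Sum>d\<le>D. q ^ d * \<delta>)"
  proof -
    have "Y * (\<Sum>d\<le>D. moebius_sum TYPE('a) d / q ^ (2 * d))
        = (\<Sum>d\<le>D. \<Sum>S\<in>(squarefree_supports d :: 'a poly set set). (-1) ^ card S * (Y / q ^ (2 * d)))"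
      unfolding moebius_sum_def
      by (simp add: sum_distrib_left sum_distrib_right sum_divide_distrib mult_ac)
    then have "(\<Sum>d\<le>D. \<Sum>S\<in>squarefree_supports d. (-1) ^ card S * N S)
        - Y * (\<Sum>d\<le>D. moebius_sum TYPE('a) d / q ^ (2 * d))
        = (\<Sum>d\<le>D. \<Sum>S\<in>squarefree_supports d. (-1) ^ card S * (N S - Y / q ^ (2 * d)))"
      by (simp add: sum_subtractf right_diff_distrib)
    also have "\<bar>\<dots>\<bar> \<le> (\<Sum>d\<le>D. \<Sum>S\<in>squarefree_supports d. \<bar>N S - Y / q ^ (2 * d)\<bar>)"
      by (intro order_trans[OF sum_abs] sum_mono) (simp add: abs_mult power_abs order_trans[OF sum_abs])
    also have "\<dots> \<le> (\<Sum>d\<le>D. \<Sum>S\<in>(squarefree_supports d :: 'a poly set set). \<delta>)"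
      using NS by (intro sum_mono) auto
    also have "\<dots> \<le> (\<Sum>d\<le>D. q ^ d * \<delta>)"
      using cardS \<delta>0 by (intro sum_mono) (simp add: mult_right_mono)
    finally show ?thesis .
  qed
  have euler: "\<bar>Y * (\<Sum>d\<le>D. moebius_sum TYPE('a) d / q ^ (2 * d)) - kappa A * P\<bar> \<le> P / q ^ D"
  proof -
    have "kappa A * P = Y * (1 / (1 + 1 / q))"
      using kappa_main_term[OF n cardA] by (simp add: P_def Y_def q_def)
    then have "Y * (\<Sum>d\<le>D. moebius_sum TYPE('a) d / q ^ (2 * d)) - kappa A * P = Y / ((q + 1) * q ^ (2 * D))"
      using truncated_euler_product[of q D, where ?'a = 'a] by (simp add: q_def distrib_left)
    moreover have "Y / ((q + 1) * q ^ (2 * D)) \<le> P / q ^ D"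
    proof (rule frac_le)
      have "q ^ D \<le> 1 * q ^ (2 * D)" using q1 by (simp add: power_increasing)
      also have "\<dots> \<le> (q + 1) * q ^ (2 * D)" using q1 by (intro mult_right_mono) auto
      finally show "q ^ D \<le> (q + 1) * q ^ (2 * D)" .
    qed (use Y P0 q1 in auto)
    moreover have "0 \<le> Y / ((q + 1) * q ^ (2 * D))" using Y q1 by simp
    ultimately show ?thesis by linarith
  qed
  have geo: "(\<Sum>d\<in>{D<..2*D}. q ^ d * \<delta>) + (\<Sum>d\<le>D. q ^ d * \<delta>) \<le> (2 * real D + 1) * q ^ (2 * D) * \<delta>"
  proof -
    have "{..2 * D} = {D<..2*D} \<union> {..D}" by auto
    then have "(\<Sum>d\<in>{D<..2*D}. q ^ d * \<delta>) + (\<Sum>d\<le>D. q ^ d * \<delta>) = (\<Sum>d\<le>2 * D. q ^ d * \<delta>)"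
      by (simp only:) (subst sum.union_disjoint, auto)
    also have "\<dots> \<le> (\<Sum>d\<le>2 * D. q ^ (2 * D) * \<delta>)"
      using q1 \<delta>0 by (intro sum_mono mult_right_mono power_increasing) auto
    finally show ?thesis by (simp add: algebra_simps)
  qed
  have "\<bar>real (card (squarefree_polys n A)) - kappa A * P\<bar>
      \<le> (2 * real D + 1) * q ^ (2 * D) * \<delta> + real D * (P / q ^ D) + P / q ^ D + (real n + 1) / 2 ^ D * P"
    using sieve large tail main euler geo by linarith
  also have "\<dots> = P * (2 * \<theta> ^ ((n - 2) div (4 * D)) * ((2 * real D + 1) * q ^ (2 * D))
        + (real D + 1) / q ^ D + (real n + 1) / 2 ^ D)"
    unfolding \<delta>_def \<eta>_def by (simp add: distrib_left distrib_right add_divide_distrib mult_ac)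
  finally show ?thesis .
qed

end

text \<open>
  The three error terms, with the level replaced by the real number \<open>n^(1/3)\<close> and the effect of rounding absorbed
  into the exponents.
\<close>
lemma error_terms_asymptotics:
  fixes q \<theta> :: real
  assumes q: "1 < q" and \<theta>: "0 < \<theta>" "\<theta> < 1"
  shows "\<forall>\<^sub>F n in at_top. 2 * \<theta> powr ((n - 2) / (4 * n powr (1/3)) - 1) * ((2 * n powr (1/3) + 1) * q powr (2 * n powr (1/3)))
    \<le> (1/3) * q powr (- (n powr (1/4)))"
    "\<forall>\<^sub>F n in at_top. (n powr (1/3) + 1) * q powr (1 - n powr (1/3)) \<le> (1/3) * q powr (- (n powr (1/4)))"
    "\<forall>\<^sub>F n in at_top. (n + 1) * 2 powr (1 - n powr (1/3)) \<le> (1/3) * q powr (- (n powr (1/4)))"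
proof -
  define L where "L = ln q"
  define c where "c = - ln \<theta>"
  have L: "L > 0" "q = exp L" and c: "c > 0" "\<theta> = exp (- c)" using q \<theta> by (auto simp: L_def c_def)
  show "\<forall>\<^sub>F n in at_top. 2 * \<theta> powr ((n - 2) / (4 * n powr (1/3)) - 1) * ((2 * n powr (1/3) + 1) * q powr (2 * n powr (1/3)))
    \<le> (1/3) * q powr (- (n powr (1/4)))"
    unfolding c(2) L(2) using L(1) c(1) by real_asymp
  show "\<forall>\<^sub>F n in at_top. (n powr (1/3) + 1) * q powr (1 - n powr (1/3)) \<le> (1/3) * q powr (- (n powr (1/4)))"
    unfolding c(2) L(2) using L(1) c(1) by real_asymp
  show "\<forall>\<^sub>F n in at_top. (n + 1) * 2 powr (1 - n powr (1/3)) \<le> (1/3) * q powr (- (n powr (1/4)))"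
    unfolding c(2) L(2) using L(1) c(1) by real_asymp
qed

section \<open>Choice of the sieve level and the asymptotic formula\<close>

text \<open>
  The level is \<open>D = \<lfloor>n^(1/3)\<rfloor>\<close>. The exponent has to exceed \<open>1/4\<close>, so that \<open>q^(-D)\<close> and \<open>n 2^(-D)\<close> are negligible,
  and to stay below \<open>1/2\<close>, so that \<open>\<theta>^((n - 2) div (4 D))\<close> outweighs \<open>q^(2 D)\<close>.
\<close>
lemma exists_sieve_level:
  fixes q \<theta> :: real and p :: nat
  assumes q: "1 < q" and \<theta>: "0 < \<theta>" "\<theta> < 1"
  shows "\<exists>n0::nat. \<forall>n\<ge>n0. \<exists>D>0. p * D \<le> n \<and>
    2 * \<theta> ^ ((n - 2) div (4 * D)) * ((2 * real D + 1) * q ^ (2 * D)) + (real D + 1) / q ^ D + (real n + 1) / 2 ^ D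
      \<le> q powr (- (real n powr (1/4)))"
proof -
  define c where "c = real p + 1"
  have "c > 0" by (simp add: c_def)
  then have "\<forall>\<^sub>F x in at_top. c * x powr (1/3) \<le> (x :: real)" by real_asymp
  moreover have "\<forall>\<^sub>F x in at_top. 1 \<le> (x :: real) powr (1/3)" by real_asymp
  ultimately have ev: "\<forall>\<^sub>F x in at_top. x \<ge> 2 \<and> 1 \<le> x powr (1/3) \<and> c * x powr (1/3) \<le> x \<and>
    2 * \<theta> powr ((x - 2) / (4 * x powr (1/3)) - 1) * ((2 * x powr (1/3) + 1) * q powr (2 * x powr (1/3)))
      \<le> (1/3) * q powr (- (x powr (1/4))) \<and>
    (x powr (1/3) + 1) * q powr (1 - x powr (1/3)) \<le> (1/3) * q powr (- (x powr (1/4))) \<and>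
    (x + 1) * 2 powr (1 - x powr (1/3)) \<le> (1/3) * q powr (- (x powr (1/4)))"
    by (intro eventually_conj error_terms_asymptotics[OF q \<theta>] eventually_ge_at_top)
  have "\<forall>\<^sub>F n in sequentially. \<exists>D>0. p * D \<le> n \<and>
    2 * \<theta> ^ ((n - 2) div (4 * D)) * ((2 * real D + 1) * q ^ (2 * D)) + (real D + 1) / q ^ D + (real n + 1) / 2 ^ D
      \<le> q powr (- (real n powr (1/4)))"
    using eventually_compose_filterlim[OF ev filterlim_real_sequentially]
  proof eventually_elim
    case (elim n)
    define x where "x = real n powr (1/3)"
    define D where "D = nat \<lfloor>x\<rfloor>"
    define E where "E = q powr (- (real n powr (1/4)))"
    have x1: "1 \<le> x" and n2: "2 \<le> n" and px: "real p * x \<le> real n"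
      using elim by (auto simp: x_def c_def distrib_right)
    have D: "real D \<le> x" "x - 1 \<le> real D" "0 < D" using x1 unfolding D_def by linarith+
    have "real (p * D) \<le> real p * x" using D(1) by (simp add: mult_left_mono)
    then have pD: "p * D \<le> n" using px by linarith
    have inv: "1 / a ^ D \<le> a powr (1 - x)" if "1 < a" for a :: real
    proof -
      have "1 / a ^ D = a powr (- real D)" using that by (simp add: powr_minus_divide powr_realpow)
      also have "\<dots> \<le> a powr (1 - x)" using that D(2) by (intro powr_mono) auto
      finally show ?thesis .
    qed
    have t1: "\<theta> ^ ((n - 2) div (4 * D)) \<le> \<theta> powr ((real n - 2) / (4 * x) - 1)"
    proof -
      have "(real n - 2) / (4 * x) - 1 \<le> real (n - 2) / real (4 * D) - 1"
        using n2 D(1,3) x1 by (simp add: of_nat_diff frac_le)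
      also have "\<dots> \<le> real ((n - 2) div (4 * D))"
        using floor_divide_of_nat_eq[of "n - 2" "4 * D", where ?'a = real] by linarith
      finally have "\<theta> powr real ((n - 2) div (4 * D)) \<le> \<theta> powr ((real n - 2) / (4 * x) - 1)"
        using \<theta> by (intro powr_mono') auto
      then show ?thesis using \<theta> by (simp add: powr_realpow)
    qed
    have t2: "(2 * real D + 1) * q ^ (2 * D) \<le> (2 * x + 1) * q powr (2 * x)"
    proof (rule mult_mono)
      have "q ^ (2 * D) = q powr (2 * real D)" using q by (simp flip: powr_realpow)
      also have "\<dots> \<le> q powr (2 * x)" using q D(1) by (intro powr_mono) auto
      finally show "q ^ (2 * D) \<le> q powr (2 * x)" .
    qed (use D q x1 in auto)
    have "2 * \<theta> ^ ((n - 2) div (4 * D)) * ((2 * real D + 1) * q ^ (2 * D))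
        \<le> 2 * \<theta> powr ((real n - 2) / (4 * x) - 1) * ((2 * x + 1) * q powr (2 * x))"
      by (rule mult_mono) (use t1 t2 \<theta> q D in auto)
    also have "\<dots> \<le> (1/3) * E" using elim unfolding x_def E_def by blast
    finally have e1: "2 * \<theta> ^ ((n - 2) div (4 * D)) * ((2 * real D + 1) * q ^ (2 * D)) \<le> (1/3) * E" .
    have "(real D + 1) * (1 / q ^ D) \<le> (x + 1) * q powr (1 - x)"
      by (rule mult_mono) (use inv[OF q] D x1 q in auto)
    also have "\<dots> \<le> (1/3) * E" using elim unfolding x_def E_def by blast
    finally have e2: "(real D + 1) / q ^ D \<le> (1/3) * E" by simp
    have "(real n + 1) * (1 / 2 ^ D) \<le> (real n + 1) * 2 powr (1 - x)"
      by (rule mult_left_mono) (use inv[of 2] in auto)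
    also have "\<dots> \<le> (1/3) * E" using elim unfolding x_def E_def by blast
    finally have e3: "(real n + 1) / 2 ^ D \<le> (1/3) * E" by simp
    from e1 e2 e3 have "2 * \<theta> ^ ((n - 2) div (4 * D)) * ((2 * real D + 1) * q ^ (2 * D))
        + (real D + 1) / q ^ D + (real n + 1) / 2 ^ D \<le> E" by linarith
    then show ?case using D(3) pD unfolding E_def by blast
  qed
  then show ?thesis unfolding eventually_sequentially .
qed

lemma squarefree_polys_subset: "squarefree_polys n A \<subseteq> restricted_polys n A"
  by (auto simp: squarefree_polys_def restricted_polys_def)

theorem corollary4p1:
  fixes p k q :: nat
  assumes "prime p" and "k \<ge> 1" and "q = p ^ k"
    and "CARD('a::finite_field) = q"
  shows "\<exists>C::real. \<forall>n\<ge>2. \<forall>A :: nat \<Rightarrow> 'a set.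
    (\<forall>i<n. \<not> (\<exists>S. Fp_affine_subspace S \<and> S \<noteq> UNIV \<and> A i \<subseteq> S)) \<longrightarrow>
    (\<exists>\<epsilon>::real. \<bar>\<epsilon>\<bar> \<le> C * real q powr (- (real n powr (1/4))) \<and>
       real (card (squarefree_polys n A)) =
         kappa A * (\<Prod>i<n. real (card (A i))) * (1 + \<epsilon>))"
proof -
  obtain \<psi> :: "'a \<Rightarrow> complex" and \<theta> where "cancelling_character \<psi> \<theta>"
    using exists_cancelling_character by (elim exE)
  then interpret cancelling_character \<psi> \<theta> .
  have "p ^ 1 \<le> p ^ k" using assms(2) prime_ge_1_nat[OF assms(1)] by (intro power_increasing) auto
  then have "1 < q" using prime_gt_1_nat[OF assms(1)] assms(3) by simp
  then have q: "1 < real q" by simp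
  have \<theta>0: "0 < \<theta>" using \<theta>_ge by simp
  obtain n0 where n0: "\<forall>n\<ge>n0. \<exists>D>0. CHAR('a) * D \<le> n \<and>
      2 * \<theta> ^ ((n - 2) div (4 * D)) * ((2 * real D + 1) * real q ^ (2 * D)) + (real D + 1) / real q ^ D + (real n + 1) / 2 ^ D
        \<le> real q powr (- (real n powr (1/4)))"
    using exists_sieve_level[OF q \<theta>0 \<theta>_less] by blast
  \<comment> \<open>For \<open>n \<ge> n0\<close> the constant \<open>2\<close> is enough, since \<open>\<kappa> \<ge> 1/2\<close>. For smaller \<open>n\<close> the bound \<open>|\<epsilon>| \<le> 2\<close> is trivial, and the
      second entry compensates for the factor \<open>q^(-n^(1/4))\<close>.\<close>
  define C where "C = max 2 (2 * real q powr (real n0 powr (1/4)))"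
  show ?thesis
  proof (rule exI[of _ C], intro allI impI)
    fix n :: nat and A :: "nat \<Rightarrow> 'a set"
    assume n: "2 \<le> n" and "\<forall>i<n. \<not> (\<exists>S. Fp_affine_subspace S \<and> S \<noteq> UNIV \<and> A i \<subseteq> S)"
    then have A: "affinely_spanning (A i)" if "i < n" for i using that by (simp add: affinely_spanning_def)
    define P where "P = (\<Prod>i<n. real (card (A i)))"
    define W where "W = real (card (squarefree_polys n A))"
    define E where "E = real q powr (- (real n powr (1/4)))"
    define \<epsilon> where "\<epsilon> = W / (kappa A * P) - 1"
    have card2: "2 \<le> card (A i)" if "i < n" for i using affinely_spanning_card_ge_2[OF A[OF that]] .
    have P: "0 < P" unfolding P_def
    proof (rule prod_pos)
      fix i assume "i \<in> {..<n}"
      then show "0 < real (card (A i))" using card2[of i] by simp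
    qed
    have \<kappa>: "1 / 2 \<le> kappa A" using card2[of 0] card2[of 1] n by (intro kappa_ge_half) auto
    then have \<kappa>P: "P / 2 \<le> kappa A * P" "0 < kappa A * P" using P by (auto intro: mult_right_mono)
    have ne: "kappa A \<noteq> 0" "P \<noteq> 0" using \<kappa> P by auto
    have E0: "0 < E" using q by (simp add: E_def)
    have "\<bar>\<epsilon>\<bar> \<le> C * E"
    proof (cases "n0 \<le> n")
      case True
      then obtain D where D: "0 < D" "CHAR('a) * D \<le> n" and
        le: "2 * \<theta> ^ ((n - 2) div (4 * D)) * ((2 * real D + 1) * real q ^ (2 * D)) + (real D + 1) / real q ^ D
          + (real n + 1) / 2 ^ D \<le> E"
        using n0 unfolding E_def by blast
      have "\<bar>W - kappa A * P\<bar> \<le> P * (2 * \<theta> ^ ((n - 2) div (4 * D)) * ((2 * real D + 1) * real q ^ (2 * D))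
          + (real D + 1) / real q ^ D + (real n + 1) / 2 ^ D)"
        using card_squarefree_polys_approx[OF n A D] by (simp only: assms(4) W_def P_def)
      also have "\<dots> \<le> P * E" using le P by (intro mult_left_mono) auto
      also have "\<dots> \<le> 2 * E * (kappa A * P)" using mult_left_mono[OF \<kappa>P(1), of "2 * E"] E0 by (simp add: mult_ac)
      finally have "\<bar>W - kappa A * P\<bar> / (kappa A * P) \<le> 2 * E" using \<kappa>P(2) by (simp add: pos_divide_le_eq)
      moreover have "\<epsilon> = (W - kappa A * P) / (kappa A * P)"
        unfolding \<epsilon>_def diff_divide_distrib using ne by simp
      then have "\<bar>\<epsilon>\<bar> = \<bar>W - kappa A * P\<bar> / (kappa A * P)" using \<kappa>P(2) by (simp only: abs_divide abs_of_pos)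
      moreover have "2 * E \<le> C * E" using E0 by (intro mult_right_mono) (auto simp: C_def)
      ultimately show ?thesis by simp
    next
      case False
      have "card (squarefree_polys n A) \<le> (\<Prod>i<n. card (A i))"
        unfolding card_restricted_polys[symmetric] by (rule card_mono) (simp_all add: squarefree_polys_subset)
      then have "W \<le> P" unfolding W_def P_def by (metis of_nat_le_iff of_nat_prod)
      then have "W \<le> 2 * (kappa A * P)" using \<kappa>P by simp
      then have "W / (kappa A * P) \<le> 2" using \<kappa>P(2) by (simp add: pos_divide_le_eq)
      moreover have "0 \<le> W / (kappa A * P)" using \<kappa>P(2) by (simp add: W_def)
      ultimately have "\<bar>\<epsilon>\<bar> \<le> 2" by (simp add: \<epsilon>_def)
      also have "2 \<le> (2 * real q powr (real n0 powr (1/4))) * E"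
      proof -
        have "real n powr (1/4) \<le> real n0 powr (1/4)" using False by (intro powr_mono2) auto
        then have "real q powr 0 \<le> real q powr (real n0 powr (1/4) + - (real n powr (1/4)))"
          using q by (intro powr_mono) auto
        then show ?thesis using q unfolding powr_add by (simp add: E_def)
      qed
      also have "\<dots> \<le> C * E" using E0 by (intro mult_right_mono) (auto simp: C_def)
      finally show ?thesis .
    qed
    moreover have "W = kappa A * P * (1 + \<epsilon>)" using ne by (simp add: \<epsilon>_def)
    ultimately show "\<exists>\<epsilon>::real. \<bar>\<epsilon>\<bar> \<le> C * real q powr (- (real n powr (1/4))) \<and>
       real (card (squarefree_polys n A)) = kappa A * (\<Prod>i<n. real (card (A i))) * (1 + \<epsilon>)"
      unfolding W_def P_def E_def by blast
  qed
qed

end
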